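(* Let $\mathcal{S}(t,u)$, $|t|<T$, be the flow of a self-adjoint one-step scheme of (even) order $p\ge 2$ applied to the evolution equation $\frac{\mathrm{d}}{\mathrm{d}t}u(t)=F(u(t))$ on $X$ with exact flow $\mathcal{E}(t,u)$. Let $$\mathcal{D}_{s}(t,u)=\partial_1\mathcal{S}(t,u)-\tfrac12\big(F(\mathcal{S}(t,u))+\partial_2\mathcal{S}(t,u)\cdot F(u)\big)$$ be the symmetrized defect and let $$\widehat{\mathcal{S}}(t,u)=\mathcal{S}(t,u)-\tfrac{t}{p+1}\,\mathcal{D}_{s}(t,u)$$ be the corrected scheme. Then for every $u_0\in X$, as $t\to 0$: (a) the corrected scheme is almost self-adjoint, i.e. $$\widehat{\mathcal{S}}\big(-t,\widehat{\mathcal{S}}(t,u_0)\big)=u_0+\mathcal{O}(t^{2p+2});$$ (b) the local error $\widehat{\mathcal{L}}(t,u)=\widehat{\mathcal{S}}(t,u)-\mathcal{E}(t,u)$ of the corrected scheme satisfies $$\widehat{\mathcal{L}}(t,u_0)=\mathcal{O}(t^{p+3}),$$ i.e. $\widehat{\mathcal{S}}$ has even order $p+2$.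
   Context: Setting: $X$ is a real Banach space (e.g. $\mathbb{R}^d$), and $F:X\to X$ is smooth ($C^\infty$) and bounded with bounded derivatives. The exact flow $\mathcal{E}:\mathbb{R}\times X\to X$ is defined by $\partial_1\mathcal{E}(t,u)=F(\mathcal{E}(t,u))$, $\mathcal{E}(0,u)=u$. Here $\partial_1$ and $\partial_2$ denote the derivatives with respect to the first argument (time) and the second argument (initial value); $\partial_2\mathcal{S}(t,u)$ is a bounded linear operator on $X$, and $\cdot$ denotes its application to a vector. The flow of a one-step scheme is a smooth map $\mathcal{S}:(-T,T)\times X\to X$ (for some $T>0$) with $\mathcal{S}(0,u)=u$ for all $u$; the first argument is the stepsize. The scheme has order $p$ if $\mathcal{S}(t,u)-\mathcal{E}(t,u)=\mathcal{O}(t^{p+1})$ as $t\to0$ for every $u\in X$. The scheme is self-adjoint (symmetric, time-reversible) if $\mathcal{S}(-t,\mathcal{S}(t,u))=u$ for all $|t|<T$ and all $u\in X$. *)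

theory Defs
  imports "HOL-Analysis.Analysis" "HOL-Library.Landau_Symbols"
begin

text \<open>A map \<open>M\<close> on lists of length \<open>k\<close> represents a bounded \<open>k\<close>-linear map. Its values on lists of
  any other length are irrelevant; for \<open>k = 0\<close> it represents the vector \<open>M []\<close>.\<close>

definition bounded_multilinear ::
  "nat \<Rightarrow> ('a::real_normed_vector list \<Rightarrow> 'b::real_normed_vector) \<Rightarrow> bool" where
  "bounded_multilinear k M \<longleftrightarrow>
     (\<forall>vs ws. length vs + 1 + length ws = k \<longrightarrow> linear (\<lambda>h. M (vs @ h # ws))) \<and>
     (\<exists>B. \<forall>vs. length vs = k \<longrightarrow> norm (M vs) \<le> B * prod_list (map norm vs))"

text \<open>\<open>D k x\<close> is the \<open>k\<close>-th Frechet derivative of \<open>f\<close> at \<open>x\<close>, viewed as a bounded \<open>k\<close>-linear map.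
  The last conjunct says that \<open>D k\<close> is Frechet differentiable at \<open>x\<close> with respect to the operator
  norm on bounded \<open>k\<close>-linear maps, with derivative \<open>h \<mapsto> D (Suc k) x (h, \<cdot>)\<close>; the estimate is
  therefore uniform in \<open>vs\<close>.\<close>

definition frechet_derivatives_on ::
  "'a::real_normed_vector set \<Rightarrow> ('a \<Rightarrow> 'b::real_normed_vector) \<Rightarrow>
     (nat \<Rightarrow> 'a \<Rightarrow> 'a list \<Rightarrow> 'b) \<Rightarrow> bool" where
  "frechet_derivatives_on A f D \<longleftrightarrow>
     open A \<and>
     (\<forall>x\<in>A. D 0 x [] = f x) \<and>
     (\<forall>k. \<forall>x\<in>A. bounded_multilinear k (D k x)) \<and>
     (\<forall>k. \<forall>x\<in>A. \<forall>e>0. \<forall>\<^sub>F y in at x. \<forall>vs. length vs = k \<longrightarrow>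
        norm (D k y vs - D k x vs - D (Suc k) x ((y - x) # vs))
          \<le> e * norm (y - x) * prod_list (map norm vs))"

definition smooth_on ::
  "'a::real_normed_vector set \<Rightarrow> ('a \<Rightarrow> 'b::real_normed_vector) \<Rightarrow> bool" where
  "smooth_on A f \<longleftrightarrow> (\<exists>D. frechet_derivatives_on A f D)"

text \<open>The case \<open>k = 0\<close> says that \<open>F\<close> itself is bounded.\<close>

definition smooth_bounded_derivatives ::
  "('a::real_normed_vector \<Rightarrow> 'b::real_normed_vector) \<Rightarrow> bool" where
  "smooth_bounded_derivatives F \<longleftrightarrow>
     (\<exists>D. frechet_derivatives_on UNIV F D \<and>
        (\<forall>k. \<exists>B. \<forall>x vs. length vs = k \<longrightarrow> norm (D k x vs) \<le> B * prod_list (map norm vs)))"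

definition exact_flow ::
  "('a::banach \<Rightarrow> 'a) \<Rightarrow> (real \<Rightarrow> 'a \<Rightarrow> 'a) \<Rightarrow> bool" where
  "exact_flow F E \<longleftrightarrow>
     (\<forall>u. E 0 u = u) \<and>
     (\<forall>t u. ((\<lambda>s. E s u) has_vector_derivative F (E t u)) (at t))"

text \<open>The flow of a scheme is only meaningful for stepsizes in \<open>(-T, T)\<close>; the values of \<open>S t\<close> for
  other \<open>t\<close> are unconstrained.\<close>

definition one_step_scheme :: "real \<Rightarrow> (real \<Rightarrow> 'a::banach \<Rightarrow> 'a) \<Rightarrow> bool" where
  "one_step_scheme T S \<longleftrightarrow>
     0 < T \<and> smooth_on ({-T<..<T} \<times> UNIV) (\<lambda>(t, u). S t u) \<and> (\<forall>u. S 0 u = u)"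

definition self_adjoint :: "real \<Rightarrow> (real \<Rightarrow> 'a::banach \<Rightarrow> 'a) \<Rightarrow> bool" where
  "self_adjoint T S \<longleftrightarrow> (\<forall>t u. \<bar>t\<bar> < T \<longrightarrow> S (- t) (S t u) = u)"

text \<open>The library's Landau symbols require values in a normed field, hence the norm. Order \<open>p\<close>
  means order at least \<open>p\<close>.\<close>

definition has_order ::
  "(real \<Rightarrow> 'a::banach \<Rightarrow> 'a) \<Rightarrow> (real \<Rightarrow> 'a \<Rightarrow> 'a) \<Rightarrow> nat \<Rightarrow> bool" where
  "has_order S E p \<longleftrightarrow> (\<forall>u. (\<lambda>t. norm (S t u - E t u)) \<in> O[at 0](\<lambda>t. t ^ (p + 1)))"

definition symmetrized_defect ::
  "('a::banach \<Rightarrow> 'a) \<Rightarrow> (real \<Rightarrow> 'a \<Rightarrow> 'a) \<Rightarrow> real \<Rightarrow> 'a \<Rightarrow> 'a" where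
  "symmetrized_defect F S t u =
     vector_derivative (\<lambda>s. S s u) (at t)
       - (1/2) *\<^sub>R (F (S t u) + frechet_derivative (\<lambda>v. S t v) (at u) (F u))"

definition corrected_scheme ::
  "('a::banach \<Rightarrow> 'a) \<Rightarrow> nat \<Rightarrow> (real \<Rightarrow> 'a \<Rightarrow> 'a) \<Rightarrow> real \<Rightarrow> 'a \<Rightarrow> 'a" where
  "corrected_scheme F p S t u = S t u - (t / real (p + 1)) *\<^sub>R symmetrized_defect F S t u"

end

theory Submission
  imports Defs
begin

text \<open>
Write \<open>d1 S\<close> and \<open>d2 S\<close> for the derivatives of the scheme in the stepsize and in the initial value.
The symmetrized defect is the mean of two one-sided defects, the usual \<^emph>\<open>defect\<close>
\<open>A(t,u) = d1 S(t,u) - F(S(t,u))\<close> and what is called the \<^emph>\<open>codefect\<close> below,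
\<open>B(t,u) = d1 S(t,u) - d2 S(t,u) F(u)\<close>. Reversibility exchanges them: differentiating
\<open>S(t, S(-t, w)) = w\<close> in the direction \<open>(1, F w)\<close> at \<open>w = S(t,u)\<close> gives
\<open>A(t,u) = d2 S(t,u) B(-t, S(t,u))\<close> (lemma \<open>defect_eq\<close>). Since \<open>d2 S(-t, S(t,u))\<close> is the inverse of
\<open>d2 S(t,u)\<close>, the mean satisfies \<open>D(-t, S(t,u)) = d2 S(-t, S(t,u)) D(t,u)\<close>
(lemma \<open>sym_defect_reverse\<close>).

This identity is the reason for (a). The corrected step subtracts \<open>h = t/(p+1) D(t,u)\<close>, which is
\<open>O(t^(p+1))\<close>, from \<open>w = S(t,u)\<close>. The backward step maps \<open>w - h\<close> to \<open>u - d2 S(-t,w) h + O(h^2)\<close>, and its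
own correction adds \<open>t/(p+1) D(-t, w - h)\<close>. Up to the variation of \<open>D(-t,_)\<close> between \<open>w\<close> and \<open>w - h\<close>
this is \<open>d2 S(-t,w) h\<close>, so the terms of first order in \<open>h\<close> cancel. The variation is
\<open>O(t^p) O(h)\<close>, because \<open>D(t,_)\<close> has a local Lipschitz constant \<open>O(t^p)\<close>. Everything left over is
\<open>O(t^(2p+2))\<close>.

For (b), the local error \<open>L = S - E\<close> has two representations:
\<open>L' = A + F(S) - F(E)\<close>, and \<open>L(t) = \<integral> B(t - s, E(s)) ds\<close> over \<open>[0,t]\<close>, because
\<open>s \<mapsto> S(t - s, E(s,u))\<close> runs from \<open>S(t,u)\<close> to \<open>E(t,u)\<close> with derivative \<open>-B(t - s, E(s,u))\<close>.
The second one is used first: it identifies the leading term of \<open>L\<close> with that of \<open>B\<close>, so by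
induction order \<open>p\<close> makes the Taylor coefficients of \<open>B\<close> below degree \<open>p\<close> vanish identically in the
initial value. Let \<open>B(t,v) = t^p b(v) + t^(p+1) g(v) + O(t^(p+2))\<close>, and let \<open>b'\<close> be the derivative of \<open>b\<close>
along \<open>F\<close>. The integral gives
\<open>L = t^(p+1)/(p+1) (b + t b') + t^(p+2)/(p+2) (g - b') + O(t^(p+3))\<close>.
As \<open>p\<close> is even, the relation between the two defects gives
\<open>A = t^p b + t^(p+1) (b' - g + F' b) + O(t^(p+2))\<close>, and the differential equation for \<open>L\<close> turns this into
\<open>L = t^(p+1)/(p+1) b + t^(p+2)/(p+2) (b' - g + F' b + F' b/(p+1)) + O(t^(p+3))\<close>.
In the mean of the two expansions the coefficient \<open>g\<close> cancels, and what remains is exactly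
\<open>t/(p+1) (A + B)/2\<close> to this order, which is the term that the corrected scheme subtracts.

The codefect is also what makes smoothness easy to exploit. The vector \<open>F(u)\<close> in it does not depend on
\<open>t\<close>, so each time derivative of \<open>B\<close> is a single value of a higher derivative of \<open>S\<close>. The defect \<open>A\<close>,
whose own derivatives would involve those of the composition of \<open>F\<close> with \<open>S\<close>, is estimated
through \<open>B\<close>. The flow \<open>E\<close> enters along single trajectories only.
\<close>

section \<open>Multilinear Taylor estimates and symmetry of the second derivative\<close>

abbreviation list_norm :: "'a::real_normed_vector list \<Rightarrow> real" where
  "list_norm vs \<equiv> prod_list (map norm vs)"

lemma list_norm_nonneg: "0 \<le> list_norm vs"
  by (induction vs) auto

lemma list_norm_replicate_unit [simp]: "list_norm (replicate j (1::real, 0::'a::real_normed_vector)) = 1"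
  by (induction j) auto

lemma bounded_multilinear_norm_bound:
  assumes "bounded_multilinear k M"
  obtains B where "0 \<le> B" "\<And>vs. length vs = k \<Longrightarrow> norm (M vs) \<le> B * list_norm vs"
proof -
  obtain B where B: "\<And>vs. length vs = k \<Longrightarrow> norm (M vs) \<le> B * list_norm vs"
    using assms unfolding bounded_multilinear_def by blast
  have "norm (M vs) \<le> max B 0 * list_norm vs" if "length vs = k" for vs
    using B[OF that] mult_right_mono[OF max.cobounded1[of B 0] list_norm_nonneg[of vs]] by linarith
  then show thesis by (intro that[of "max B 0"]) auto
qed

lemma bounded_multilinear_bounded_linear:
  assumes "bounded_multilinear k M" "length vs + 1 + length ws = k"
  shows "bounded_linear (\<lambda>h. M (vs @ h # ws))"
proof -
  obtain B where B: "\<And>vs. length vs = k \<Longrightarrow> norm (M vs) \<le> B * list_norm vs"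
    using bounded_multilinear_norm_bound[OF assms(1)] by metis
  have "linear (\<lambda>h. M (vs @ h # ws))"
    using assms unfolding bounded_multilinear_def by blast
  moreover have "norm (M (vs @ h # ws)) \<le> norm h * (B * list_norm vs * list_norm ws)" for h
    using B[of "vs @ h # ws"] assms(2) by (simp add: algebra_simps)
  ultimately show ?thesis
    unfolding bounded_linear_def bounded_linear_axioms_def by blast
qed

lemma frechet_derivatives_bounded_linear:
  assumes "frechet_derivatives_on A f D" "x \<in> A" "length vs + 1 + length ws = k"
  shows "bounded_linear (\<lambda>h. D k x (vs @ h # ws))"
  using assms bounded_multilinear_bounded_linear unfolding frechet_derivatives_on_def by blast

text \<open>The instances of linearity in one slot. Higher-order matching does not find them by rewriting with
\<open>linear\<close> rules, because the slot sits inside a list.\<close>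

lemma frechet_derivatives_linear:
  assumes "frechet_derivatives_on A f D" "x \<in> A" "length vs + 1 + length ws = k"
  shows "D k x (vs @ (a + b) # ws) = D k x (vs @ a # ws) + D k x (vs @ b # ws)"
    and "D k x (vs @ (a - b) # ws) = D k x (vs @ a # ws) - D k x (vs @ b # ws)"
    and "D k x (vs @ (c *\<^sub>R a) # ws) = c *\<^sub>R D k x (vs @ a # ws)"
    and "D k x (vs @ (- a) # ws) = - D k x (vs @ a # ws)"
    and "D k x (vs @ 0 # ws) = 0"
proof -
  interpret bounded_linear "\<lambda>h. D k x (vs @ h # ws)"
    using frechet_derivatives_bounded_linear[OF assms] .
  show "D k x (vs @ (a + b) # ws) = D k x (vs @ a # ws) + D k x (vs @ b # ws)" by (rule add)
  show "D k x (vs @ (a - b) # ws) = D k x (vs @ a # ws) - D k x (vs @ b # ws)" by (rule diff)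
  show "D k x (vs @ (c *\<^sub>R a) # ws) = c *\<^sub>R D k x (vs @ a # ws)" by (rule scaleR)
  show "D k x (vs @ (- a) # ws) = - D k x (vs @ a # ws)" using linear_neg[OF linear_axioms] .
  show "D k x (vs @ 0 # ws) = 0" by (rule zero)
qed

lemma has_derivative_frechet_derivatives:
  assumes "frechet_derivatives_on A f D" "x \<in> A" "length vs = k"
  shows "((\<lambda>y. D k y vs) has_derivative (\<lambda>h. D (Suc k) x (h # vs))) (at x)"
  unfolding has_derivative_at_alt
proof (intro conjI allI impI)
  show "bounded_linear (\<lambda>h. D (Suc k) x (h # vs))"
    using frechet_derivatives_bounded_linear[OF assms(1,2), of "[]" vs] assms(3) by simp
next
  fix e :: real assume e: "e > 0"
  define e' where "e' = e / (list_norm vs + 1)"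
  have n: "0 < list_norm vs + 1" using list_norm_nonneg[of vs] by linarith
  have e': "e' > 0" unfolding e'_def using e n by (rule divide_pos_pos)
  have "e' * list_norm vs \<le> e' * (list_norm vs + 1)" using e' by (intro mult_left_mono) auto
  also have "\<dots> = e" using n unfolding e'_def by (metis less_irrefl nonzero_eq_divide_eq)
  finally have le: "e' * list_norm vs \<le> e" .
  have "\<forall>\<^sub>F y in at x. \<forall>vs. length vs = k \<longrightarrow>
      norm (D k y vs - D k x vs - D (Suc k) x ((y - x) # vs)) \<le> e' * norm (y - x) * list_norm vs"
    using assms(1,2) e' unfolding frechet_derivatives_on_def by blast
  then obtain d where "d > 0" and d: "\<And>y. y \<noteq> x \<Longrightarrow> dist y x < d \<Longrightarrow>
      norm (D k y vs - D k x vs - D (Suc k) x ((y - x) # vs)) \<le> e' * norm (y - x) * list_norm vs"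
    using assms(3) unfolding eventually_at by auto
  have lin: "D (Suc k) x (0 # vs) = 0"
    using frechet_derivatives_linear(5)[OF assms(1,2), of "[]" vs] assms(3) by simp
  have "norm (D k y vs - D k x vs - D (Suc k) x ((y - x) # vs)) \<le> e * norm (y - x)"
    if "norm (y - x) < d" for y
  proof (cases "y = x")
    case False
    have "norm (D k y vs - D k x vs - D (Suc k) x ((y - x) # vs)) \<le> (e' * list_norm vs) * norm (y - x)"
      using d[OF False] that by (simp add: dist_norm mult_ac)
    also have "\<dots> \<le> e * norm (y - x)" by (intro mult_right_mono le) auto
    finally show ?thesis .
  qed (simp add: lin)
  then show "\<exists>d>0. \<forall>y. norm (y - x) < d \<longrightarrow>
      norm (D k y vs - D k x vs - D (Suc k) x ((y - x) # vs)) \<le> e * norm (y - x)"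
    using \<open>d > 0\<close> by blast
qed

text \<open>Differentiability in the operator norm at \<open>x\<close> bounds the whole multilinear map at nearby points, with a
constant that does not depend on the arguments.\<close>

lemma frechet_derivatives_locally_bounded:
  assumes "frechet_derivatives_on A f D" "x \<in> A"
  obtains r M where "r > 0" "M \<ge> 0" "ball x r \<subseteq> A"
    "\<And>y vs. y \<in> ball x r \<Longrightarrow> length vs = k \<Longrightarrow> norm (D k y vs) \<le> M * list_norm vs"
proof -
  have ml: "bounded_multilinear k (D k x)" "bounded_multilinear (Suc k) (D (Suc k) x)" and "open A"
    using assms unfolding frechet_derivatives_on_def by auto
  obtain B where B: "0 \<le> B" "\<And>vs. length vs = k \<Longrightarrow> norm (D k x vs) \<le> B * list_norm vs"
    using bounded_multilinear_norm_bound[OF ml(1)] by metis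
  obtain B' where B': "0 \<le> B'" "\<And>vs. length vs = Suc k \<Longrightarrow> norm (D (Suc k) x vs) \<le> B' * list_norm vs"
    using bounded_multilinear_norm_bound[OF ml(2)] by metis
  have "\<forall>\<^sub>F y in at x. \<forall>vs. length vs = k \<longrightarrow>
        norm (D k y vs - D k x vs - D (Suc k) x ((y - x) # vs)) \<le> 1 * norm (y - x) * list_norm vs"
    using assms zero_less_one unfolding frechet_derivatives_on_def by blast
  then obtain d where d: "d > 0" "\<And>y vs. y \<noteq> x \<Longrightarrow> dist y x < d \<Longrightarrow> length vs = k \<Longrightarrow>
        norm (D k y vs - D k x vs - D (Suc k) x ((y - x) # vs)) \<le> norm (y - x) * list_norm vs"
    unfolding eventually_at by auto
  obtain d' where d': "d' > 0" "ball x d' \<subseteq> A"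
    using \<open>open A\<close> assms(2) by (meson open_contains_ball)
  define r where "r = min d d'"
  define M where "M = B + B' * d + d"
  have "norm (D k y vs) \<le> M * list_norm vs" if y: "y \<in> ball x r" and vs: "length vs = k" for y vs
  proof (cases "y = x")
    case True
    have "B * list_norm vs \<le> M * list_norm vs"
      using B B' d by (intro mult_right_mono list_norm_nonneg) (auto simp: M_def)
    then show ?thesis unfolding True using B(2)[OF vs] by linarith
  next
    case False
    have yd: "norm (y - x) \<le> d" using y by (auto simp: r_def dist_norm norm_minus_commute)
    have "norm (D k y vs) \<le> norm (D k y vs - D k x vs - D (Suc k) x ((y - x) # vs))
        + norm (D k x vs) + norm (D (Suc k) x ((y - x) # vs))"
      by (smt (verit, best) norm_triangle_ineq2)
    also have "\<dots> \<le> norm (y - x) * list_norm vs + B * list_norm vs + B' * (norm (y - x) * list_norm vs)"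
      using d(2)[OF False _ vs] y B(2)[OF vs] B'(2)[of "(y - x) # vs"] vs
      by (intro add_mono) (auto simp: r_def dist_commute)
    also have "\<dots> = (B + B' * norm (y - x) + norm (y - x)) * list_norm vs" by (simp add: algebra_simps)
    also have "\<dots> \<le> M * list_norm vs"
      using yd B'(1) unfolding M_def
      by (intro mult_right_mono add_mono mult_left_mono list_norm_nonneg) auto
    finally show ?thesis .
  qed
  moreover have "r > 0" "M \<ge> 0" "ball x r \<subseteq> A"
    using d d' B B' by (auto simp: r_def M_def)
  ultimately show thesis using that by blast
qed

text \<open>The mean value inequality turns the local bounds of the derivatives of orders \<open>k + 1\<close> and \<open>k + 2\<close> into a
Lipschitz estimate and a quadratic Taylor remainder for the derivative of order \<open>k\<close>. Every later
estimate of \<open>S\<close> and \<open>F\<close> rests on these three bounds, which are uniform in base point and arguments.\<close>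

lemma frechet_derivatives_local_estimates:
  assumes "frechet_derivatives_on A f D" "x \<in> A"
  obtains r M where "r > 0" "M \<ge> 0" "ball x r \<subseteq> A"
    "\<And>y vs. y \<in> ball x r \<Longrightarrow> length vs = k \<Longrightarrow> norm (D k y vs) \<le> M * list_norm vs"
    "\<And>y z vs. y \<in> ball x r \<Longrightarrow> z \<in> ball x r \<Longrightarrow> length vs = k \<Longrightarrow>
       norm (D k y vs - D k z vs) \<le> M * norm (y - z) * list_norm vs"
    "\<And>y z vs. y \<in> ball x r \<Longrightarrow> z \<in> ball x r \<Longrightarrow> length vs = k \<Longrightarrow>
       norm (D k y vs - D k z vs - D (Suc k) z ((y - z) # vs)) \<le> M * (norm (y - z))\<^sup>2 * list_norm vs"
proof -
  have lip: "norm (D j y vs - D j z vs) \<le> M * norm (y - z) * list_norm vs"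
    if bd: "\<And>y vs. y \<in> ball x r \<Longrightarrow> length vs = Suc j \<Longrightarrow> norm (D (Suc j) y vs) \<le> M * list_norm vs"
    and M: "M \<ge> 0" and sub: "ball x r \<subseteq> A" and y: "y \<in> ball x r" and z: "z \<in> ball x r"
    and vs: "length vs = j" for j r M y z vs
  proof -
    have "norm (D j y vs - D j z vs) \<le> (M * list_norm vs) * norm (y - z)"
    proof (rule differentiable_bound[OF convex_ball _ _ y z])
      fix w assume w: "w \<in> ball x r"
      show "((\<lambda>y. D j y vs) has_derivative (\<lambda>h. D (Suc j) w (h # vs))) (at w within ball x r)"
        using has_derivative_frechet_derivatives[OF assms(1) _ vs] w sub
        by (blast intro: has_derivative_at_withinI)
      show "onorm (\<lambda>h. D (Suc j) w (h # vs)) \<le> M * list_norm vs"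
        using bd[OF w, of "_ # vs"] vs M list_norm_nonneg[of vs]
        by (intro onorm_bound) (auto simp: mult_ac)
    qed
    then show ?thesis by (simp add: mult_ac)
  qed
  obtain r0 M0 where 0: "r0 > 0" "M0 \<ge> 0" "ball x r0 \<subseteq> A"
    "\<And>y vs. y \<in> ball x r0 \<Longrightarrow> length vs = k \<Longrightarrow> norm (D k y vs) \<le> M0 * list_norm vs"
    using frechet_derivatives_locally_bounded[OF assms, where k = k] by blast
  obtain r1 M1 where 1: "r1 > 0" "M1 \<ge> 0" "ball x r1 \<subseteq> A"
    "\<And>y vs. y \<in> ball x r1 \<Longrightarrow> length vs = Suc k \<Longrightarrow> norm (D (Suc k) y vs) \<le> M1 * list_norm vs"
    using frechet_derivatives_locally_bounded[OF assms, where k = "Suc k"] by blast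
  obtain r2 M2 where 2: "r2 > 0" "M2 \<ge> 0" "ball x r2 \<subseteq> A"
    "\<And>y vs. y \<in> ball x r2 \<Longrightarrow> length vs = Suc (Suc k) \<Longrightarrow> norm (D (Suc (Suc k)) y vs) \<le> M2 * list_norm vs"
    using frechet_derivatives_locally_bounded[OF assms, where k = "Suc (Suc k)"] by blast
  define r where "r = min r0 (min r1 r2)"
  define M where "M = max M0 (max M1 M2)"
  have rM: "r > 0" "M \<ge> 0" "ball x r \<subseteq> A" using 0 1 2 by (auto simp: r_def M_def)
  have bd: "norm (D k y vs) \<le> M * list_norm vs" if "y \<in> ball x r" "length vs = k" for y vs
  proof -
    have "norm (D k y vs) \<le> M0 * list_norm vs" using 0(4) that by (auto simp: r_def)
    also have "\<dots> \<le> M * list_norm vs" by (intro mult_right_mono list_norm_nonneg) (simp add: M_def)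
    finally show ?thesis .
  qed
  have bd1: "norm (D (Suc k) y vs) \<le> M * list_norm vs" if "y \<in> ball x r" "length vs = Suc k" for y vs
  proof -
    have "norm (D (Suc k) y vs) \<le> M1 * list_norm vs" using 1(4) that by (auto simp: r_def)
    also have "\<dots> \<le> M * list_norm vs" by (intro mult_right_mono list_norm_nonneg) (simp add: M_def)
    finally show ?thesis .
  qed
  have bd2: "norm (D (Suc (Suc k)) y vs) \<le> M * list_norm vs"
    if "y \<in> ball x r" "length vs = Suc (Suc k)" for y vs
  proof -
    have "norm (D (Suc (Suc k)) y vs) \<le> M2 * list_norm vs" using 2(4) that by (auto simp: r_def)
    also have "\<dots> \<le> M * list_norm vs" by (intro mult_right_mono list_norm_nonneg) (simp add: M_def)
    finally show ?thesis .
  qed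
  have quad: "norm (D k y vs - D k z vs - D (Suc k) z ((y - z) # vs)) \<le> M * (norm (y - z))\<^sup>2 * list_norm vs"
    if y: "y \<in> ball x r" and z: "z \<in> ball x r" and vs: "length vs = k" for y z vs
  proof -
    have zA: "z \<in> A" using z rM by blast
    have bl: "bounded_linear (\<lambda>h. D (Suc k) z (h # vs))"
      using has_derivative_frechet_derivatives[OF assms(1) zA vs] by (rule has_derivative_bounded_linear)
    let ?S = "closed_segment z y"
    have seg: "w \<in> ball x r" if "w \<in> ?S" for w
      using that y z convex_ball by (metis convex_contains_segment subsetD)
    \<comment> \<open>Mean value inequality for \<open>w \<mapsto> D k w vs\<close> minus its linearization at \<open>z\<close>.\<close>
    have "norm ((D k y vs - D (Suc k) z (y # vs)) - (D k z vs - D (Suc k) z (z # vs)))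
        \<le> (M * norm (y - z) * list_norm vs) * norm (y - z)"
    proof (rule differentiable_bound[OF convex_closed_segment[of z y]])
      fix w assume w: "w \<in> ?S"
      have wA: "w \<in> A" using seg[OF w] rM by blast
      show "((\<lambda>w. D k w vs - D (Suc k) z (w # vs)) has_derivative
          (\<lambda>h. D (Suc k) w (h # vs) - D (Suc k) z (h # vs))) (at w within ?S)"
        by (intro has_derivative_diff bounded_linear_imp_has_derivative bl
            has_derivative_at_withinI[OF has_derivative_frechet_derivatives[OF assms(1) wA vs]])
      show "onorm (\<lambda>h. D (Suc k) w (h # vs) - D (Suc k) z (h # vs)) \<le> M * norm (y - z) * list_norm vs"
      proof (rule onorm_bound)
        fix h
        have "norm (D (Suc k) w (h # vs) - D (Suc k) z (h # vs)) \<le> M * norm (w - z) * list_norm (h # vs)"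
          using lip[OF bd2 rM(2,3) seg[OF w] z, of "h # vs"] vs by simp
        also have "\<dots> \<le> M * norm (y - z) * list_norm (h # vs)"
          using segment_bound1[OF w] rM(2) 
          by (intro mult_right_mono mult_left_mono list_norm_nonneg) auto
        finally show "norm (D (Suc k) w (h # vs) - D (Suc k) z (h # vs))
            \<le> M * norm (y - z) * list_norm vs * norm h" by (simp add: mult_ac)
      qed (use rM(2) list_norm_nonneg[of vs] in simp)
    qed auto
    moreover have "D (Suc k) z ((y - z) # vs) = D (Suc k) z (y # vs) - D (Suc k) z (z # vs)"
      using frechet_derivatives_linear(2)[OF assms(1) zA, of "[]" vs] vs by simp
    ultimately show ?thesis
      by (simp only: diff_diff_eq2 diff_diff_eq add_diff_eq diff_add_eq power2_eq_square mult_ac add_ac)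
  qed
  show thesis
    by (rule that[OF rM bd lip[OF bd1 rM(2,3)] quad])
qed

text \<open>Both sides are the limit of the second difference of \<open>f\<close> over the parallelogram spanned by
\<open>s h\<close> and \<open>s k\<close>, divided by \<open>s^2\<close>; the error is \<open>O(s)\<close> by the Taylor estimates.\<close>

lemma second_derivative_symmetric:
  assumes "frechet_derivatives_on A f D" "x \<in> A"
  shows "D 2 x [h, k] = D 2 x [k, h]"
proof -
  obtain r1 M1 where 1: "r1 > 0" "M1 \<ge> 0" "ball x r1 \<subseteq> A"
    "\<And>y z vs. y \<in> ball x r1 \<Longrightarrow> z \<in> ball x r1 \<Longrightarrow> length vs = 1 \<Longrightarrow>
       norm (D 1 y vs - D 1 z vs - D (Suc 1) z ((y - z) # vs)) \<le> M1 * (norm (y - z))\<^sup>2 * list_norm vs"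
    using frechet_derivatives_local_estimates[OF assms, where k = 1] by metis
  obtain r2 M2 where 2: "r2 > 0" "M2 \<ge> 0" "ball x r2 \<subseteq> A"
    "\<And>y z vs. y \<in> ball x r2 \<Longrightarrow> z \<in> ball x r2 \<Longrightarrow> length vs = 2 \<Longrightarrow>
       norm (D 2 y vs - D 2 z vs) \<le> M2 * norm (y - z) * list_norm vs"
    using frechet_derivatives_local_estimates[OF assms, where k = 2] by metis
  define r where "r = min r1 r2"
  have r: "r > 0" "ball x r \<subseteq> A" using 1 2 by (auto simp: r_def)
  have lin: "bounded_linear (\<lambda>h. D 2 x [v, h])" for v
    using frechet_derivatives_bounded_linear[OF assms, of "[v]" "[]" 2] by simp
  have main: "norm (f (x + s *\<^sub>R h + s *\<^sub>R k) - f (x + s *\<^sub>R h) - f (x + s *\<^sub>R k) + f x - s\<^sup>2 *\<^sub>R D 2 x [k, h])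
      \<le> s ^ 3 * ((M1 * (norm k)\<^sup>2 + M2 * norm h * norm k) * norm h)"
    if s: "s > 0" "s * (norm h + norm k) < r" for s h k
  proof -
    let ?S = "closed_segment x (x + s *\<^sub>R h)"
    have wb: "norm (w - x) \<le> s * norm h" if "w \<in> ?S" for w
      using segment_bound1[OF that] s by simp
    have sk: "0 \<le> s * norm k" "0 \<le> s * norm h" using s by simp_all
    have wr: "w \<in> ball x r" if "w \<in> ?S" for w
      using wb[OF that] s(2) sk by (auto simp: dist_norm norm_minus_commute distrib_left)
    have wkr: "w + s *\<^sub>R k \<in> ball x r" if "w \<in> ?S" for w
    proof -
      have "norm (w + s *\<^sub>R k - x) \<le> norm (w - x) + norm (s *\<^sub>R k)"
        by (metis add_diff_eq add.commute norm_triangle_ineq)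
      then show ?thesis
        using wb[OF that] s by (auto simp: dist_norm norm_minus_commute distrib_left)
    qed
    \<comment> \<open>Mean value inequality along \<open>h\<close> for the first difference along \<open>k\<close>, minus its expected linear part.\<close>
    have "norm ((D 0 (x + s *\<^sub>R h + s *\<^sub>R k) [] - D 0 (x + s *\<^sub>R h) [] - D 2 x [s *\<^sub>R k, x + s *\<^sub>R h])
        - (D 0 (x + s *\<^sub>R k) [] - D 0 x [] - D 2 x [s *\<^sub>R k, x]))
      \<le> (s\<^sup>2 * (M1 * (norm k)\<^sup>2 + M2 * norm h * norm k)) * norm (x + s *\<^sub>R h - x)"
    proof (rule differentiable_bound[OF convex_closed_segment[of x "x + s *\<^sub>R h"]])
      fix w assume w: "w \<in> ?S"
      have wA: "w \<in> A" "w + s *\<^sub>R k \<in> A" using wr[OF w] wkr[OF w] r by auto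
      have "((\<lambda>w. w + s *\<^sub>R k) has_derivative (\<lambda>h. h)) (at w)"
        by (auto intro!: derivative_eq_intros)
      from has_derivative_compose[OF this, of "\<lambda>y. D 0 y []" "\<lambda>h. D (Suc 0) (w + s *\<^sub>R k) [h]"]
      have d1: "((\<lambda>w. D 0 (w + s *\<^sub>R k) []) has_derivative (\<lambda>h. D (Suc 0) (w + s *\<^sub>R k) [h])) (at w)"
        using has_derivative_frechet_derivatives[OF assms(1) wA(2), of "[]" 0] by simp
      have d2: "((\<lambda>w. D 0 w []) has_derivative (\<lambda>h. D (Suc 0) w [h])) (at w)"
        using has_derivative_frechet_derivatives[OF assms(1) wA(1), of "[]" 0] by simp
      have d3: "((\<lambda>w. D 2 x [s *\<^sub>R k, w]) has_derivative (\<lambda>h. D 2 x [s *\<^sub>R k, h])) (at w)"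
        by (rule bounded_linear_imp_has_derivative[OF lin])
      show "((\<lambda>w. D 0 (w + s *\<^sub>R k) [] - D 0 w [] - D 2 x [s *\<^sub>R k, w]) has_derivative
          (\<lambda>h. D (Suc 0) (w + s *\<^sub>R k) [h] - D (Suc 0) w [h] - D 2 x [s *\<^sub>R k, h])) (at w within ?S)"
        by (rule has_derivative_at_withinI[OF has_derivative_diff[OF has_derivative_diff[OF d1 d2] d3]])
      show "onorm (\<lambda>h. D (Suc 0) (w + s *\<^sub>R k) [h] - D (Suc 0) w [h] - D 2 x [s *\<^sub>R k, h])
          \<le> s\<^sup>2 * (M1 * (norm k)\<^sup>2 + M2 * norm h * norm k)"
      proof (rule onorm_bound)
        fix g
        have "norm (D 1 (w + s *\<^sub>R k) [g] - D 1 w [g] - D 2 w [s *\<^sub>R k, g])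
            \<le> M1 * (norm (s *\<^sub>R k))\<^sup>2 * norm g"
          using 1(4)[of "w + s *\<^sub>R k" w "[g]"] wr[OF w] wkr[OF w]
          by (auto simp: r_def numeral_2_eq_2)
        moreover have "norm (D 2 w [s *\<^sub>R k, g] - D 2 x [s *\<^sub>R k, g]) \<le> M2 * (s * norm h) * (s * norm k * norm g)"
        proof -
          have "norm (D 2 w [s *\<^sub>R k, g] - D 2 x [s *\<^sub>R k, g]) \<le> M2 * norm (w - x) * (s * norm k * norm g)"
            using 2(4)[of w x "[s *\<^sub>R k, g]"] wr[OF w] s 2(1) by (simp add: r_def mult.assoc)
          also have "\<dots> \<le> M2 * (s * norm h) * (s * norm k * norm g)"
            using wb[OF w] 2 s by (intro mult_right_mono mult_left_mono) auto
          finally show ?thesis .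
        qed
        moreover have "norm (D (Suc 0) (w + s *\<^sub>R k) [g] - D (Suc 0) w [g] - D 2 x [s *\<^sub>R k, g])
          \<le> norm (D 1 (w + s *\<^sub>R k) [g] - D 1 w [g] - D 2 w [s *\<^sub>R k, g])
            + norm (D 2 w [s *\<^sub>R k, g] - D 2 x [s *\<^sub>R k, g])"
          using norm_triangle_ineq[of "D 1 (w + s *\<^sub>R k) [g] - D 1 w [g] - D 2 w [s *\<^sub>R k, g]"
            "D 2 w [s *\<^sub>R k, g] - D 2 x [s *\<^sub>R k, g]"] by simp
        ultimately have "norm (D (Suc 0) (w + s *\<^sub>R k) [g] - D (Suc 0) w [g] - D 2 x [s *\<^sub>R k, g])
          \<le> M1 * (s * norm k)\<^sup>2 * norm g + M2 * (s * norm h) * (s * norm k * norm g)"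
          using s by simp
        then show "norm (D (Suc 0) (w + s *\<^sub>R k) [g] - D (Suc 0) w [g] - D 2 x [s *\<^sub>R k, g])
            \<le> s\<^sup>2 * (M1 * (norm k)\<^sup>2 + M2 * norm h * norm k) * norm g"
          by (simp add: algebra_simps power2_eq_square)
      qed (use 1 2 in simp)
    qed auto
    moreover have "D 2 x [s *\<^sub>R k, x + s *\<^sub>R h] - D 2 x [s *\<^sub>R k, x] = s\<^sup>2 *\<^sub>R D 2 x [k, h]"
    proof -
      have "D 2 x [s *\<^sub>R k, x + s *\<^sub>R h] = D 2 x [s *\<^sub>R k, x] + s *\<^sub>R D 2 x [s *\<^sub>R k, h]"
        using frechet_derivatives_linear(1)[OF assms, of "[s *\<^sub>R k]" "[]" 2 x "s *\<^sub>R h"]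
          frechet_derivatives_linear(3)[OF assms, of "[s *\<^sub>R k]" "[]" 2 s h] by simp
      moreover have "D 2 x [s *\<^sub>R k, h] = s *\<^sub>R D 2 x [k, h]"
        using frechet_derivatives_linear(3)[OF assms, of "[]" "[h]" 2 s k] by simp
      ultimately show ?thesis by (simp add: power2_eq_square)
    qed
    moreover have "D 0 y [] = f y" if "y \<in> ball x r" for y
      using assms(1) that r(2) unfolding frechet_derivatives_on_def by blast
    ultimately show ?thesis
      using wr[of x] wr[of "x + s *\<^sub>R h"] wkr[of x] wkr[of "x + s *\<^sub>R h"] s
      by (simp add: algebra_simps power2_eq_square power3_eq_cube)
  qed
  define C where "C = (M1 * (norm k)\<^sup>2 + M2 * norm h * norm k) * norm h
    + (M1 * (norm h)\<^sup>2 + M2 * norm k * norm h) * norm k"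
  have bound: "norm (D 2 x [h, k] - D 2 x [k, h]) \<le> s * C" if s: "s > 0" "s * (norm h + norm k) < r" for s
  proof -
    let ?\<Delta> = "f (x + s *\<^sub>R h + s *\<^sub>R k) - f (x + s *\<^sub>R h) - f (x + s *\<^sub>R k) + f x"
    have "?\<Delta> = f (x + s *\<^sub>R k + s *\<^sub>R h) - f (x + s *\<^sub>R k) - f (x + s *\<^sub>R h) + f x"
      by (simp add: algebra_simps)
    then have "norm (?\<Delta> - s\<^sup>2 *\<^sub>R D 2 x [h, k]) \<le> s ^ 3 * ((M1 * (norm h)\<^sup>2 + M2 * norm k * norm h) * norm k)"
      using main[of s k h] s by (simp only: add.commute)
    moreover note main[of s h k] 
    ultimately have "norm ((?\<Delta> - s\<^sup>2 *\<^sub>R D 2 x [k, h]) - (?\<Delta> - s\<^sup>2 *\<^sub>R D 2 x [h, k])) \<le> s ^ 3 * C"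
      using s norm_triangle_ineq4[of "?\<Delta> - s\<^sup>2 *\<^sub>R D 2 x [k, h]" "?\<Delta> - s\<^sup>2 *\<^sub>R D 2 x [h, k]"]
      unfolding C_def distrib_left by linarith
    then have "norm (s\<^sup>2 *\<^sub>R (D 2 x [h, k] - D 2 x [k, h])) \<le> s ^ 3 * C"
      by (simp add: algebra_simps)
    then have "s\<^sup>2 * norm (D 2 x [h, k] - D 2 x [k, h]) \<le> s\<^sup>2 * (s * C)"
      by (simp add: power2_eq_square power3_eq_cube mult_ac)
    then show ?thesis using s by simp
  qed
  have "((\<lambda>s. s * (norm h + norm k)) \<longlongrightarrow> 0 * (norm h + norm k)) (at_right 0)"
    by (intro tendsto_intros)
  then have "\<forall>\<^sub>F s in at_right 0. s * (norm h + norm k) < r"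
    using r(1) by (intro order_tendstoD(2)) auto
  then have "\<forall>\<^sub>F s in at_right 0. norm (D 2 x [h, k] - D 2 x [k, h]) \<le> s * C"
    using eventually_at_right_less[of 0] by eventually_elim (use bound in auto)
  moreover have "((\<lambda>s. s * C) \<longlongrightarrow> 0 * C) (at_right (0::real))"
    by (intro tendsto_intros)
  ultimately have "norm (D 2 x [h, k] - D 2 x [k, h]) \<le> 0"
    by (intro tendsto_lowerbound[of _ "0 * C", simplified]) auto
  then show ?thesis by simp
qed

section \<open>Vector-valued functions of size $O(t^n)$\<close>

text \<open>Taking the norm inside makes Landau's notation available for functions with values in a normed space.\<close>

definition O_pow :: "nat \<Rightarrow> (real \<Rightarrow> 'a::real_normed_vector) \<Rightarrow> bool" where
  "O_pow n f \<longleftrightarrow> (\<lambda>t. norm (f t)) \<in> O[at 0](\<lambda>t. t ^ n)"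

lemma O_pow_iff:
  "O_pow n f \<longleftrightarrow> (\<exists>K d. 0 < d \<and> (\<forall>t. t \<noteq> 0 \<longrightarrow> \<bar>t\<bar> < d \<longrightarrow> norm (f t) \<le> K * \<bar>t\<bar> ^ n))"
proof
  assume "O_pow n f"
  then obtain c where "\<forall>\<^sub>F t in at 0. norm (norm (f t)) \<le> c * norm (t ^ n)"
    unfolding O_pow_def by (elim landau_o.bigE)
  then show "\<exists>K d. 0 < d \<and> (\<forall>t. t \<noteq> 0 \<longrightarrow> \<bar>t\<bar> < d \<longrightarrow> norm (f t) \<le> K * \<bar>t\<bar> ^ n)"
    unfolding eventually_at by (auto simp: dist_real_def power_abs)
next
  assume "\<exists>K d. 0 < d \<and> (\<forall>t. t \<noteq> 0 \<longrightarrow> \<bar>t\<bar> < d \<longrightarrow> norm (f t) \<le> K * \<bar>t\<bar> ^ n)"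
  then obtain K d where "0 < d" "\<And>t. t \<noteq> 0 \<Longrightarrow> \<bar>t\<bar> < d \<Longrightarrow> norm (f t) \<le> K * \<bar>t\<bar> ^ n"
    by blast
  then have "\<forall>\<^sub>F t in at 0. norm (norm (f t)) \<le> K * norm (t ^ n)"
    unfolding eventually_at by (auto simp: dist_real_def power_abs intro!: exI[of _ d])
  then show "O_pow n f" unfolding O_pow_def by (rule bigoI)
qed

lemma O_powI:
  assumes "0 < d" "\<And>t. t \<noteq> 0 \<Longrightarrow> \<bar>t\<bar> < d \<Longrightarrow> norm (f t) \<le> K * \<bar>t\<bar> ^ n"
  shows "O_pow n f"
  using assms unfolding O_pow_iff by blast

lemma O_powE:
  assumes "O_pow n f"
  obtains K d where "0 < d" "0 \<le> K" "\<And>t. t \<noteq> 0 \<Longrightarrow> \<bar>t\<bar> < d \<Longrightarrow> norm (f t) \<le> K * \<bar>t\<bar> ^ n"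
proof -
  obtain K d where K: "0 < d" "\<And>t. t \<noteq> 0 \<Longrightarrow> \<bar>t\<bar> < d \<Longrightarrow> norm (f t) \<le> K * \<bar>t\<bar> ^ n"
    using assms unfolding O_pow_iff by blast
  have "norm (f t) \<le> max K 0 * \<bar>t\<bar> ^ n" if "t \<noteq> 0" "\<bar>t\<bar> < d" for t
    using K(2)[OF that] mult_right_mono[OF max.cobounded1[of K 0], of "\<bar>t\<bar> ^ n"] by simp
  then show thesis using that[of d "max K 0"] K(1) by simp
qed

lemma O_pow_dominated:
  assumes "0 < d" "O_pow n g" "\<And>t. t \<noteq> 0 \<Longrightarrow> \<bar>t\<bar> < d \<Longrightarrow> norm (f t) \<le> C * norm (g t)" "0 \<le> C"
  shows "O_pow n f"
proof -
  obtain K d' where K: "0 < d'" "0 \<le> K" "\<And>t. t \<noteq> 0 \<Longrightarrow> \<bar>t\<bar> < d' \<Longrightarrow> norm (g t) \<le> K * \<bar>t\<bar> ^ n"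
    using O_powE[OF assms(2)] by metis
  show ?thesis
  proof (rule O_powI)
    show "0 < min d d'" using assms K by simp
    fix t :: real assume "t \<noteq> 0" "\<bar>t\<bar> < min d d'"
    then have "norm (f t) \<le> C * norm (g t)" "norm (g t) \<le> K * \<bar>t\<bar> ^ n" using assms K by auto
    then show "norm (f t) \<le> (C * K) * \<bar>t\<bar> ^ n"
      using assms(4) mult_left_mono by (fastforce simp: mult.assoc)
  qed
qed

lemma O_pow_cong:
  assumes "O_pow n f" "0 < d" "\<And>t. t \<noteq> 0 \<Longrightarrow> \<bar>t\<bar> < d \<Longrightarrow> g t = f t"
  shows "O_pow n g"
  by (rule O_pow_dominated[OF assms(2,1), of _ 1]) (use assms in auto)

lemma O_pow_add: "O_pow n f \<Longrightarrow> O_pow n g \<Longrightarrow> O_pow n (\<lambda>t. f t + g t)"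
proof -
  assume "O_pow n f" "O_pow n g"
  then obtain K d K' d' where K: "0 < d" "\<And>t. t \<noteq> 0 \<Longrightarrow> \<bar>t\<bar> < d \<Longrightarrow> norm (f t) \<le> K * \<bar>t\<bar> ^ n"
    and K': "0 < d'" "\<And>t. t \<noteq> 0 \<Longrightarrow> \<bar>t\<bar> < d' \<Longrightarrow> norm (g t) \<le> K' * \<bar>t\<bar> ^ n"
    by (metis O_powE)
  show ?thesis
  proof (rule O_powI)
    show "0 < min d d'" using K K' by simp
    fix t :: real assume "t \<noteq> 0" "\<bar>t\<bar> < min d d'"
    then have "norm (f t) \<le> K * \<bar>t\<bar> ^ n" "norm (g t) \<le> K' * \<bar>t\<bar> ^ n" using K K' by auto
    then show "norm (f t + g t) \<le> (K + K') * \<bar>t\<bar> ^ n"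
      using norm_triangle_ineq[of "f t" "g t"] by (simp add: distrib_right)
  qed
qed

lemma O_pow_bounded_linear:
  assumes "bounded_linear h" "O_pow n f"
  shows "O_pow n (\<lambda>t. h (f t))"
proof -
  obtain C where "0 < C" "\<And>x. norm (h x) \<le> norm x * C"
    using bounded_linear.pos_bounded[OF assms(1)] by blast
  then show ?thesis
    by (intro O_pow_dominated[OF zero_less_one assms(2), of _ C]) (auto simp: mult.commute)
qed

lemma O_pow_minus: "O_pow n f \<Longrightarrow> O_pow n (\<lambda>t. - f t)"
  by (simp add: O_pow_def)

lemma O_pow_diff: "O_pow n f \<Longrightarrow> O_pow n g \<Longrightarrow> O_pow n (\<lambda>t. f t - g t)"
  using O_pow_add[of n f "\<lambda>t. - g t"] O_pow_minus[of n g] by simp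

lemma O_pow_scaleR: "O_pow n f \<Longrightarrow> O_pow n (\<lambda>t. c *\<^sub>R f t)"
  by (rule O_pow_bounded_linear[OF bounded_linear_scaleR_right])

lemma O_pow_scaleR_power:
  assumes "O_pow n f"
  shows "O_pow (k + n) (\<lambda>t. t ^ k *\<^sub>R f t)"
proof -
  obtain K d where K: "0 < d" "\<And>t. t \<noteq> 0 \<Longrightarrow> \<bar>t\<bar> < d \<Longrightarrow> norm (f t) \<le> K * \<bar>t\<bar> ^ n"
    using O_powE[OF assms] by metis
  show ?thesis
  proof (rule O_powI[OF K(1)])
    fix t :: real assume "t \<noteq> 0" "\<bar>t\<bar> < d"
    then show "norm (t ^ k *\<^sub>R f t) \<le> K * \<bar>t\<bar> ^ (k + n)"
      using mult_left_mono[OF K(2), of t "\<bar>t\<bar> ^ k"] by (simp add: power_add power_abs mult_ac)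
  qed
qed

lemma O_pow_scaleR_id: "O_pow n f \<Longrightarrow> O_pow (Suc n) (\<lambda>t. t *\<^sub>R f t)"
  using O_pow_scaleR_power[of n f 1] by simp

lemma O_pow_const: "O_pow 0 (\<lambda>t. c)"
  by (rule O_powI[of 1 _ "norm c"]) auto

lemma O_pow_power: "O_pow n (\<lambda>t. t ^ n *\<^sub>R c)"
  using O_pow_scaleR_power[OF O_pow_const, of n c] by simp

lemma O_pow_mono:
  assumes "O_pow m f" "n \<le> m"
  shows "O_pow n f"
proof -
  obtain K d where K: "0 < d" "0 \<le> K" "\<And>t. t \<noteq> 0 \<Longrightarrow> \<bar>t\<bar> < d \<Longrightarrow> norm (f t) \<le> K * \<bar>t\<bar> ^ m"
    using O_powE[OF assms(1)] by metis
  show ?thesis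
  proof (rule O_powI)
    show "0 < min d 1" using K by simp
    fix t :: real assume "t \<noteq> 0" "\<bar>t\<bar> < min d 1"
    then show "norm (f t) \<le> K * \<bar>t\<bar> ^ n"
      using K(3)[of t] mult_left_mono[OF power_decreasing[OF assms(2), of "\<bar>t\<bar>"] K(2)] by simp
  qed
qed

lemma O_pow_tendsto_0:
  assumes "O_pow (Suc n) f"
  shows "(f \<longlongrightarrow> 0) (at 0)"
proof -
  obtain K d where K: "0 < d" "\<And>t. t \<noteq> 0 \<Longrightarrow> \<bar>t\<bar> < d \<Longrightarrow> norm (f t) \<le> K * \<bar>t\<bar> ^ Suc n"
    using O_powE[OF assms] by metis
  have "((\<lambda>t. K * \<bar>t\<bar> ^ Suc n) \<longlongrightarrow> K * \<bar>0\<bar> ^ Suc n) (at (0::real))"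
    by (intro tendsto_intros)
  moreover have "\<forall>\<^sub>F t in at 0. norm (f t) \<le> K * \<bar>t\<bar> ^ Suc n"
    unfolding eventually_at using K by (auto simp: dist_real_def)
  ultimately show ?thesis using Lim_null_comparison[of f "\<lambda>t. K * \<bar>t\<bar> ^ Suc n" "at 0"] by simp
qed

text \<open>Comparison of coefficients: a leading term that is smaller than its own power of \<open>t\<close> is zero.\<close>

lemma O_pow_power_coefficient_0:
  assumes "O_pow (Suc n) (\<lambda>t. t ^ n *\<^sub>R c)"
  shows "c = 0"
proof -
  obtain K d where K: "0 < d" "\<And>t. t \<noteq> 0 \<Longrightarrow> \<bar>t\<bar> < d \<Longrightarrow> norm (t ^ n *\<^sub>R c) \<le> K * \<bar>t\<bar> ^ Suc n"
    using O_powE[OF assms] by metis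
  have "O_pow (Suc 0) (\<lambda>t. c)"
  proof (rule O_powI[OF K(1)])
    fix t :: real assume t: "t \<noteq> 0" "\<bar>t\<bar> < d"
    have "\<bar>t\<bar> ^ n * norm c \<le> \<bar>t\<bar> ^ n * (K * \<bar>t\<bar>)" using K(2)[OF t] by (simp add: power_abs mult_ac)
    then show "norm c \<le> K * \<bar>t\<bar> ^ Suc 0" using t by simp
  qed
  then have "((\<lambda>t. c) \<longlongrightarrow> 0) (at (0::real))" by (rule O_pow_tendsto_0)
  then show ?thesis by (simp add: tendsto_const_iff)
qed

lemma O_pow_mult_dominated:
  assumes "O_pow m f" "O_pow n g" "0 < d" "0 \<le> C"
    and "\<And>t. t \<noteq> 0 \<Longrightarrow> \<bar>t\<bar> < d \<Longrightarrow> norm (h t) \<le> C * norm (f t) * norm (g t)"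
  shows "O_pow (m + n) h"
proof -
  obtain K d' where K: "0 < d'" "0 \<le> K" "\<And>t. t \<noteq> 0 \<Longrightarrow> \<bar>t\<bar> < d' \<Longrightarrow> norm (f t) \<le> K * \<bar>t\<bar> ^ m"
    using O_powE[OF assms(1)] by metis
  show ?thesis
  proof (rule O_pow_dominated)
    show "0 < min d d'" using assms K by simp
    show "O_pow (m + n) (\<lambda>t. t ^ m *\<^sub>R g t)" by (rule O_pow_scaleR_power[OF assms(2)])
    fix t :: real assume t: "t \<noteq> 0" "\<bar>t\<bar> < min d d'"
    have "norm (h t) \<le> C * norm (f t) * norm (g t)" using assms(5) t by simp
    also have "\<dots> \<le> C * (K * \<bar>t\<bar> ^ m) * norm (g t)"
      using K(3) t assms(4) by (intro mult_right_mono mult_left_mono) auto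
    finally show "norm (h t) \<le> (C * K) * norm (t ^ m *\<^sub>R g t)" by (simp add: power_abs mult_ac)
  qed (use assms K in simp)
qed

lemma O_pow_0_isCont:
  assumes "isCont f 0"
  shows "O_pow 0 f"
proof -
  have "\<forall>\<^sub>F t in at 0. dist (f t) (f 0) < 1"
    using assms unfolding isCont_def by (rule tendstoD) simp
  then obtain d where d: "0 < d" "\<And>t. t \<noteq> 0 \<Longrightarrow> \<bar>t\<bar> < d \<Longrightarrow> dist (f t) (f 0) < 1"
    unfolding eventually_at by (auto simp: dist_real_def)
  show ?thesis
  proof (rule O_powI[OF d(1)])
    fix t assume "t \<noteq> 0" "\<bar>t\<bar> < d"
    then have "norm (f t - f 0) < 1" using d(2)[of t] by (simp add: dist_norm)
    then show "norm (f t) \<le> (1 + norm (f 0)) * \<bar>t\<bar> ^ 0"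
      using norm_triangle_ineq2[of "f t" "f 0"] by simp
  qed
qed

text \<open>The mean value inequality on the interval between \<open>0\<close> and \<open>t\<close>, whatever the sign of \<open>t\<close>. The point \<open>0\<close> is
left out of the bound on the derivative because \<open>O(t^n)\<close> estimates say nothing there.\<close>

lemma norm_increment_le:
  fixes g :: "real \<Rightarrow> 'a::real_normed_vector"
  assumes "\<And>s. \<bar>s\<bar> \<le> \<bar>t\<bar> \<Longrightarrow> (g has_vector_derivative g' s) (at s)"
    and "\<And>s. s \<noteq> 0 \<Longrightarrow> \<bar>s\<bar> \<le> \<bar>t\<bar> \<Longrightarrow> norm (g' s) \<le> C"
  shows "norm (g t - g 0) \<le> C * \<bar>t\<bar>"
proof (cases "t = 0")
  case False
  define a b where "a = min 0 t" and "b = max 0 t"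
  have ab: "a < b" "\<bar>s\<bar> \<le> \<bar>t\<bar>" if "a \<le> s" "s \<le> b" for s using that False by (auto simp: a_def b_def)
  have "norm (g b - g a) \<le> C * b - C * a"
  proof (rule differentiable_bound_general[of a b g "\<lambda>s. C * s" g' "\<lambda>_. C"])
    show "a < b" using False by (auto simp: a_def b_def)
    show "continuous_on {a..b} g"
      using assms(1) ab by (intro continuous_at_imp_continuous_on ballI has_vector_derivative_continuous) auto
    show "continuous_on {a..b} (\<lambda>s. C * s)" by (intro continuous_intros)
    fix s assume s: "a < s" "s < b"
    show "(g has_vector_derivative g' s) (at s)" using assms(1) ab s by simp
    show "((\<lambda>s. C * s) has_vector_derivative C) (at s)"
      unfolding has_real_derivative_iff_has_vector_derivative[symmetric]
      by (auto intro!: derivative_eq_intros)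
    show "norm (g' s) \<le> C" using assms(2)[of s] ab s by (auto simp: a_def b_def)
  qed
  then show ?thesis
    by (cases "t \<ge> 0") (auto simp: a_def b_def norm_minus_commute)
qed simp

lemma norm_le_power_of_derivative:
  fixes g :: "real \<Rightarrow> 'a::real_normed_vector"
  assumes "g 0 = 0" "\<And>s. \<bar>s\<bar> < r \<Longrightarrow> (g has_vector_derivative g' s) (at s)"
    and "\<And>s. s \<noteq> 0 \<Longrightarrow> \<bar>s\<bar> < r \<Longrightarrow> norm (g' s) \<le> M * \<bar>s\<bar> ^ n" and "\<bar>t\<bar> < r" "0 \<le> M"
  shows "norm (g t) \<le> M * \<bar>t\<bar> ^ Suc n"
proof -
  have "norm (g' s) \<le> M * \<bar>t\<bar> ^ n" if s: "s \<noteq> 0" "\<bar>s\<bar> \<le> \<bar>t\<bar>" for s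
  proof -
    have "norm (g' s) \<le> M * \<bar>s\<bar> ^ n" using s assms(3,4) by simp
    also have "\<dots> \<le> M * \<bar>t\<bar> ^ n" using s assms(5) by (intro mult_left_mono power_mono) auto
    finally show ?thesis .
  qed
  then have "norm (g t - g 0) \<le> (M * \<bar>t\<bar> ^ n) * \<bar>t\<bar>"
    using assms(2,4) by (intro norm_increment_le) auto
  then show ?thesis using assms(1) by (simp add: mult_ac)
qed

text \<open>Integration gains one power of \<open>t\<close>.\<close>

lemma O_pow_of_derivative:
  assumes "g 0 = 0" "0 < r" "\<And>s. \<bar>s\<bar> < r \<Longrightarrow> (g has_vector_derivative g' s) (at s)" "O_pow n g'"
  shows "O_pow (Suc n) g"
proof -
  obtain K d where K: "0 < d" "0 \<le> K" "\<And>t. t \<noteq> 0 \<Longrightarrow> \<bar>t\<bar> < d \<Longrightarrow> norm (g' t) \<le> K * \<bar>t\<bar> ^ n"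
    using O_powE[OF assms(4)] by metis
  show ?thesis
  proof (rule O_powI)
    show "0 < min d r" using K assms by simp
    fix t :: real assume "\<bar>t\<bar> < min d r"
    then show "norm (g t) \<le> K * \<bar>t\<bar> ^ Suc n"
      using K assms by (intro norm_le_power_of_derivative[where r = "min d r" and g' = g']) auto
  qed
qed

text \<open>The derivative of the remainder of order \<open>n + 1\<close> is the remainder of order \<open>n\<close> for the shifted family of
derivatives, so the bound follows by repeated use of the mean value inequality. The factor \<open>1/n!\<close> is given
away.\<close>

lemma taylor_remainder_bound:
  fixes f :: "nat \<Rightarrow> real \<Rightarrow> 'a::real_normed_vector"
  assumes "\<And>j s. \<bar>s\<bar> < r \<Longrightarrow> (f j has_vector_derivative f (Suc j) s) (at s)"
    and "\<And>s. \<bar>s\<bar> < r \<Longrightarrow> norm (f n s) \<le> M" and "\<bar>t\<bar> < r"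
  shows "norm (f 0 t - (\<Sum>j<n. (t ^ j / fact j) *\<^sub>R f j 0)) \<le> M * \<bar>t\<bar> ^ n"
  using assms
proof (induction n arbitrary: f t)
  case (Suc n)
  have M: "0 \<le> M" using Suc.prems(2)[of t] Suc.prems(3) norm_ge_zero order_trans by blast
  let ?R = "\<lambda>f t. f 0 t - (\<Sum>j<n. (t ^ j / fact j) *\<^sub>R f j 0)"
  have "norm (f 0 t - (\<Sum>j<Suc n. (t ^ j / fact j) *\<^sub>R f j 0)) \<le> M * \<bar>t\<bar> ^ Suc n"
  proof (rule norm_le_power_of_derivative[OF _ _ _ Suc.prems(3) M])
    show "f 0 0 - (\<Sum>j<Suc n. (0 ^ j / fact j) *\<^sub>R f j 0) = 0"
      by (simp add: sum.lessThan_Suc_shift del: sum.lessThan_Suc)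
    fix s :: real assume s: "\<bar>s\<bar> < r"
    have pow: "((\<lambda>s. (s ^ Suc j / fact (Suc j)) *\<^sub>R c) has_vector_derivative (s ^ j / fact j) *\<^sub>R c) (at s)"
      for j and c :: 'a
    proof -
      have "((\<lambda>s. s ^ Suc j / fact (Suc j)) has_real_derivative (s ^ j / fact j)) (at s)"
        using DERIV_cdivide[OF DERIV_pow[of "Suc j" s UNIV], of "fact (Suc j)"]
        by (simp add: divide_simps del: power_Suc of_nat_Suc)
      then show ?thesis
        using has_vector_derivative_scaleR[of "\<lambda>s. s ^ Suc j / fact (Suc j)" _ s UNIV "\<lambda>_. c" 0] by simp
    qed
    have "((\<lambda>t. f 0 t - (f 0 0 + (\<Sum>j<n. (t ^ Suc j / fact (Suc j)) *\<^sub>R f (Suc j) 0)))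
        has_vector_derivative f (Suc 0) s - (0 + (\<Sum>j<n. (s ^ j / fact j) *\<^sub>R f (Suc j) 0))) (at s)"
      by (intro has_vector_derivative_diff has_vector_derivative_add has_vector_derivative_sum
          has_vector_derivative_const pow Suc.prems(1) s)
    then show "((\<lambda>t. f 0 t - (\<Sum>j<Suc n. (t ^ j / fact j) *\<^sub>R f j 0))
        has_vector_derivative ?R (\<lambda>j. f (Suc j)) s) (at s)"
      unfolding sum.lessThan_Suc_shift by simp
    show "norm (?R (\<lambda>j. f (Suc j)) s) \<le> M * \<bar>s\<bar> ^ n"
      using Suc.IH[of "\<lambda>j. f (Suc j)" s] Suc.prems s by blast
  qed
  then show ?case .
qed auto

lemma O_pow_eventually_small:
  assumes "O_pow (Suc n) f" "0 < (r::real)"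
  obtains d where "0 < d" "\<And>t. t \<noteq> 0 \<Longrightarrow> \<bar>t\<bar> < d \<Longrightarrow> norm (f t) < r"
proof -
  have "\<forall>\<^sub>F t in at 0. dist (f t) 0 < r"
    using O_pow_tendsto_0[OF assms(1)] assms(2) by (rule tendstoD)
  then show thesis unfolding eventually_at by (auto simp: dist_real_def intro: that)
qed

lemma O_pow_1_of_velocity:
  assumes "O_pow 2 (\<lambda>t. c t - u - t *\<^sub>R w)"
  shows "O_pow 1 (\<lambda>t. c t - u)"
  using O_pow_add[OF O_pow_mono[OF assms, of 1] O_pow_power[of 1 w]] by simp

section \<open>The codefect and its Taylor coefficients\<close>

text \<open>The higher derivatives of \<open>S\<close> and \<open>F\<close> are parameters, because the defects are expressed through their
values.\<close>

locale scheme_and_flow =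
  fixes F :: "'a::banach \<Rightarrow> 'a" and E S :: "real \<Rightarrow> 'a \<Rightarrow> 'a" and T :: real
    and D :: "nat \<Rightarrow> real \<times> 'a \<Rightarrow> (real \<times> 'a) list \<Rightarrow> 'a"
    and DF :: "nat \<Rightarrow> 'a \<Rightarrow> 'a list \<Rightarrow> 'a"
  assumes derivatives_F: "frechet_derivatives_on UNIV F DF"
    and derivatives_S: "frechet_derivatives_on ({-T<..<T} \<times> UNIV) (\<lambda>(t, u). S t u) D"
    and T_pos: "0 < T" and S_0: "S 0 u = u" and exact_flow: "exact_flow F E"
begin

lemma E_0: "E 0 u = u"
  and E_derivative: "((\<lambda>s. E s u) has_vector_derivative F (E t u)) (at t)"
  using exact_flow unfolding exact_flow_def by auto

lemma D_0: "\<bar>t\<bar> < T \<Longrightarrow> D 0 (t, u) [] = S t u"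
  using derivatives_S unfolding frechet_derivatives_on_def by (auto simp: abs_less_iff)

lemma DF_0: "DF 0 u [] = F u"
  using derivatives_F unfolding frechet_derivatives_on_def by auto

lemma in_domain: "\<bar>t\<bar> < T \<Longrightarrow> (t, u) \<in> {-T<..<T} \<times> UNIV"
  by auto

lemmas D_linear = frechet_derivatives_linear[OF derivatives_S in_domain]
lemmas DF_linear = frechet_derivatives_linear[OF derivatives_F UNIV_I]
lemmas D_bounded_linear = frechet_derivatives_bounded_linear[OF derivatives_S in_domain]

text \<open>The local estimates at \<open>(0, u)\<close>, on a box in place of a ball, so that stepsize and initial value can be
controlled separately.\<close>

lemma D_local:
  obtains r M where "0 < r" "r \<le> T" "0 \<le> M"
    "\<And>t v vs. \<bar>t\<bar> < r \<Longrightarrow> norm (v - u) < r \<Longrightarrow> length vs = k \<Longrightarrow> norm (D k (t, v) vs) \<le> M * list_norm vs"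
    "\<And>s v t w vs. \<bar>s\<bar> < r \<Longrightarrow> norm (v - u) < r \<Longrightarrow> \<bar>t\<bar> < r \<Longrightarrow> norm (w - u) < r \<Longrightarrow> length vs = k \<Longrightarrow>
       norm (D k (s, v) vs - D k (t, w) vs) \<le> M * norm (s - t, v - w) * list_norm vs"
    "\<And>s v t w vs. \<bar>s\<bar> < r \<Longrightarrow> norm (v - u) < r \<Longrightarrow> \<bar>t\<bar> < r \<Longrightarrow> norm (w - u) < r \<Longrightarrow> length vs = k \<Longrightarrow>
       norm (D k (s, v) vs - D k (t, w) vs - D (Suc k) (t, w) ((s - t, v - w) # vs))
         \<le> M * (norm (s - t, v - w))\<^sup>2 * list_norm vs"
proof -
  have "(0, u) \<in> {-T<..<T} \<times> UNIV" using T_pos by simp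
  from frechet_derivatives_local_estimates[OF derivatives_S this, where k = k]
  obtain r M where r: "0 < r" "0 \<le> M" 
    "\<And>y vs. y \<in> ball (0, u) r \<Longrightarrow> length vs = k \<Longrightarrow> norm (D k y vs) \<le> M * list_norm vs"
    "\<And>y z vs. y \<in> ball (0, u) r \<Longrightarrow> z \<in> ball (0, u) r \<Longrightarrow> length vs = k \<Longrightarrow>
       norm (D k y vs - D k z vs) \<le> M * norm (y - z) * list_norm vs"
    "\<And>y z vs. y \<in> ball (0, u) r \<Longrightarrow> z \<in> ball (0, u) r \<Longrightarrow> length vs = k \<Longrightarrow>
       norm (D k y vs - D k z vs - D (Suc k) z ((y - z) # vs)) \<le> M * (norm (y - z))\<^sup>2 * list_norm vs"
    by metis
  define r' where "r' = min (r / 2) T"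
  have box: "(t, v) \<in> ball (0, u) r" if "\<bar>t\<bar> < r'" "norm (v - u) < r'" for t v
  proof -
    have "norm (t, v - u) \<le> \<bar>t\<bar> + norm (v - u)" using norm_Pair_le[of t "v - u"] by simp
    moreover have "dist (0, u) (t, v) = norm (t, v - u)" by (subst dist_commute) (simp add: dist_norm)
    ultimately show ?thesis using that by (simp add: r'_def)
  qed
  show thesis
  proof (rule that[of r' M])
    show "0 < r'" "r' \<le> T" "0 \<le> M" using r T_pos by (auto simp: r'_def)
  qed (use r(3) r(4)[OF box box] r(5)[OF box box] box in \<open>simp_all del: mem_ball\<close>)
qed

lemma F_local:
  obtains r M where "0 < r" "0 \<le> M"
    "\<And>v. norm (v - u) < r \<Longrightarrow> norm (F v) \<le> M"
    "\<And>v w. norm (v - u) < r \<Longrightarrow> norm (w - u) < r \<Longrightarrow> norm (F v - F w) \<le> M * norm (v - w)"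
    "\<And>v w. norm (v - u) < r \<Longrightarrow> norm (w - u) < r \<Longrightarrow>
       norm (F v - F w - DF 1 w [v - w]) \<le> M * (norm (v - w))\<^sup>2"
proof -
  from frechet_derivatives_local_estimates[OF derivatives_F UNIV_I[of u], where k = 0]
  obtain r M where r: "0 < r" "0 \<le> M" 
    "\<And>y. y \<in> ball u r \<Longrightarrow> norm (DF 0 y []) \<le> M"
    "\<And>y z. y \<in> ball u r \<Longrightarrow> z \<in> ball u r \<Longrightarrow> norm (DF 0 y [] - DF 0 z []) \<le> M * norm (y - z)"
    "\<And>y z. y \<in> ball u r \<Longrightarrow> z \<in> ball u r \<Longrightarrow>
       norm (DF 0 y [] - DF 0 z [] - DF 1 z [y - z]) \<le> M * (norm (y - z))\<^sup>2"
    by (metis One_nat_def list.map(1) list.size(3) mult.right_neutral prod_list.Nil)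
  then show thesis
    by (intro that[of r M]) (auto simp: DF_0 dist_norm norm_minus_commute)
qed

lemma S_has_derivative:
  assumes "\<bar>t\<bar> < T"
  shows "((\<lambda>(t, u). S t u) has_derivative (\<lambda>h. D 1 (t, u) [h])) (at (t, u))"
proof (rule has_derivative_transform_within_open)
  show "((\<lambda>y. D 0 y []) has_derivative (\<lambda>h. D 1 (t, u) [h])) (at (t, u))"
    using has_derivative_frechet_derivatives[OF derivatives_S in_domain[OF assms], of "[]" 0 u] by simp
  show "open ({-T<..<T} \<times> (UNIV :: 'a set))" by (intro open_Times) auto
qed (use assms in \<open>auto simp: D_0 abs_less_iff\<close>)

lemma S_has_time_derivative:
  assumes "\<bar>t\<bar> < T"
  shows "((\<lambda>s. S s u) has_vector_derivative D 1 (t, u) [(1, 0)]) (at t)"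
proof -
  have "((\<lambda>s. (s, u)) has_derivative (\<lambda>h. (h, 0))) (at t)"
    by (auto intro!: derivative_eq_intros)
  from has_derivative_compose[OF this S_has_derivative[OF assms]]
  have "((\<lambda>s. S s u) has_derivative (\<lambda>h. D 1 (t, u) [(h, 0)])) (at t)" by simp
  moreover have scale: "D 1 (t, u) [(h, 0)] = h *\<^sub>R D 1 (t, u) [(1, 0)]" for h
    using D_linear(3)[OF assms, of "[]" "[]" 1 u h "(1, 0)"] by simp
  have "(\<lambda>h. D 1 (t, u) [(h, 0)]) = (\<lambda>h. h *\<^sub>R D 1 (t, u) [(1, 0)])"
    by (rule ext) (rule scale)
  ultimately show ?thesis unfolding has_vector_derivative_def by (simp only:)
qed

lemma S_has_space_derivative:
  assumes "\<bar>t\<bar> < T"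
  shows "(S t has_derivative (\<lambda>h. D 1 (t, u) [(0, h)])) (at u)"
proof -
  have "((\<lambda>v. (t, v)) has_derivative (\<lambda>h. (0, h))) (at u)"
    by (auto intro!: derivative_eq_intros)
  from has_derivative_compose[OF this S_has_derivative[OF assms]]
  show ?thesis by simp
qed

lemma D_1_space_0: "D 1 (0, u) [(0, h)] = h"
proof -
  have "S 0 = (\<lambda>v. v)" using S_0 by auto
  then have "((\<lambda>v. v) has_derivative (\<lambda>h. D 1 (0, u) [(0, h)])) (at u)"
    using S_has_space_derivative[of 0 u] T_pos by simp
  from has_derivative_unique[OF this has_derivative_ident] show ?thesis by metis
qed

text \<open>The case \<open>j = 0\<close> is \<open>d1 S(t,v) - d2 S(t,v) F(v)\<close>, written as one directional derivative of \<open>S\<close>. Since the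
direction \<open>(1, - F v)\<close> does not change with \<open>t\<close>, inserting further copies of \<open>(1, 0)\<close> gives the \<open>j\<close>-th time
derivative.\<close>

definition codefect :: "nat \<Rightarrow> real \<Rightarrow> 'a \<Rightarrow> 'a" where
  "codefect j t v = D (Suc j) (t, v) (replicate j (1, 0) @ [(1, - F v)])"

lemma codefect_has_derivative:
  assumes "\<bar>t\<bar> < T"
  shows "((\<lambda>s. codefect j s v) has_vector_derivative codefect (Suc j) t v) (at t)"
proof -
  let ?vs = "replicate j (1, 0) @ [(1, - F v)]"
  have "((\<lambda>s. (s, v)) has_derivative (\<lambda>h. (h, 0))) (at t)"
    by (auto intro!: derivative_eq_intros)
  from has_derivative_compose[OF this has_derivative_frechet_derivatives[OF derivatives_S in_domain[OF assms], of ?vs "Suc j"]]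
  have "((\<lambda>s. codefect j s v) has_derivative (\<lambda>h. D (Suc (Suc j)) (t, v) ((h, 0) # ?vs))) (at t)"
    unfolding codefect_def by simp
  moreover have "D (Suc (Suc j)) (t, v) ((h, 0) # ?vs) = h *\<^sub>R codefect (Suc j) t v" for h
    using D_linear(3)[OF assms, of "[]" ?vs "Suc (Suc j)" v h "(1, 0)"] by (simp add: codefect_def)
  ultimately show ?thesis unfolding has_vector_derivative_def by simp
qed

text \<open>The Lipschitz dependence on \<open>v\<close> has two sources, the base point of the derivative of \<open>S\<close> and the direction
\<open>(1, - F v)\<close>.\<close>

lemma codefect_local:
  obtains r M where "0 < r" "r \<le> T" "0 \<le> M"
    "\<And>t v. \<bar>t\<bar> < r \<Longrightarrow> norm (v - u) < r \<Longrightarrow> norm (codefect j t v) \<le> M"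
    "\<And>t v w. \<bar>t\<bar> < r \<Longrightarrow> norm (v - u) < r \<Longrightarrow> norm (w - u) < r \<Longrightarrow>
       norm (codefect j t v - codefect j t w) \<le> M * norm (v - w)"
proof -
  obtain r1 M1 where 1: "0 < r1" "r1 \<le> T" "0 \<le> M1"
    "\<And>t v vs. \<bar>t\<bar> < r1 \<Longrightarrow> norm (v - u) < r1 \<Longrightarrow> length vs = Suc j \<Longrightarrow> norm (D (Suc j) (t, v) vs) \<le> M1 * list_norm vs"
    "\<And>s v t w vs. \<bar>s\<bar> < r1 \<Longrightarrow> norm (v - u) < r1 \<Longrightarrow> \<bar>t\<bar> < r1 \<Longrightarrow> norm (w - u) < r1 \<Longrightarrow> length vs = Suc j \<Longrightarrow>
       norm (D (Suc j) (s, v) vs - D (Suc j) (t, w) vs) \<le> M1 * norm (s - t, v - w) * list_norm vs"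
    using D_local[of u "Suc j"] by metis
  obtain r2 M2 where 2: "0 < r2" "0 \<le> M2" "\<And>v. norm (v - u) < r2 \<Longrightarrow> norm (F v) \<le> M2"
    "\<And>v w. norm (v - u) < r2 \<Longrightarrow> norm (w - u) < r2 \<Longrightarrow> norm (F v - F w) \<le> M2 * norm (v - w)"
    using F_local[of u] by metis
  define r where "r = min r1 r2"
  define M where "M = M1 * (1 + 2 * M2)"
  let ?e = "replicate j (1::real, 0::'a)"
  have dir: "norm (1::real, - F v) \<le> 1 + M2" if "norm (v - u) < r" for v
    using norm_Pair_le[of "1::real" "- F v"] 2(3)[of v] that by (simp add: r_def)
  have bd: "norm (codefect j t v) \<le> M" if "\<bar>t\<bar> < r" "norm (v - u) < r" for t v
  proof -
    have "norm (codefect j t v) \<le> M1 * norm (1::real, - F v)"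
      using 1(4)[of t v "?e @ [(1, - F v)]"] that by (simp add: codefect_def r_def)
    also have "\<dots> \<le> M" unfolding M_def using dir[OF that(2)] 1(3) 2(2) by (intro mult_left_mono) auto
    finally show ?thesis .
  qed
  have lip: "norm (codefect j t v - codefect j t w) \<le> M * norm (v - w)"
    if t: "\<bar>t\<bar> < r" and v: "norm (v - u) < r" and w: "norm (w - u) < r" for t v w
  proof -
    let ?g = "\<lambda>v. ?e @ [(1, - F v)]"
    have tT: "\<bar>t\<bar> < T" using t 1 by (simp add: r_def)
    have "codefect j t v - codefect j t w = (D (Suc j) (t, v) (?g v) - D (Suc j) (t, w) (?g v))
        + D (Suc j) (t, w) (?e @ [(0, - (F v - F w))])"
      using D_linear(2)[OF tT, of ?e "[]" "Suc j" w "(1, - F v)" "(1, - F w)"] by (simp add: codefect_def)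
    also have "norm \<dots> \<le> M1 * norm (v - w) * (1 + M2) + M1 * (M2 * norm (v - w))"
    proof (rule norm_triangle_mono)
      have "norm (D (Suc j) (t, v) (?g v) - D (Suc j) (t, w) (?g v)) \<le> M1 * norm (v - w) * norm (1::real, - F v)"
        using 1(5)[of t v t w "?g v"] t v w by (simp add: r_def)
      also have "\<dots> \<le> M1 * norm (v - w) * (1 + M2)" using dir[OF v] 1(3) by (intro mult_left_mono) auto
      finally show "norm (D (Suc j) (t, v) (?g v) - D (Suc j) (t, w) (?g v)) \<le> M1 * norm (v - w) * (1 + M2)" .
      have "norm (D (Suc j) (t, w) (?e @ [(0, - (F v - F w))])) \<le> M1 * norm (F v - F w)"
        using 1(4)[of t w "?e @ [(0, - (F v - F w))]"] t w by (simp add: r_def norm_minus_commute)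
      also have "\<dots> \<le> M1 * (M2 * norm (v - w))" using 2(4)[of v w] v w 1(3) by (intro mult_left_mono) (auto simp: r_def)
      finally show "norm (D (Suc j) (t, w) (?e @ [(0, - (F v - F w))])) \<le> M1 * (M2 * norm (v - w))" .
    qed
    also have "\<dots> = (M1 * (1 + 2 * M2)) * norm (v - w)" by (simp add: algebra_simps)
    finally show ?thesis unfolding M_def .
  qed
  show thesis
    using bd lip 1 2 by (intro that[of r M]) (auto simp: r_def M_def)
qed

lemma E_minus_initial: "O_pow 1 (\<lambda>t. E t u - u)"
proof -
  have "isCont (\<lambda>t. E t u) 0" by (rule has_vector_derivative_continuous[OF E_derivative])
  moreover have "isCont F v" for v
    using has_derivative_frechet_derivatives[OF derivatives_F UNIV_I, of "[]" 0 v]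
    by (auto simp: DF_0 dest: has_derivative_continuous)
  ultimately have "isCont (\<lambda>t. F (E t u)) 0" using isCont_o2 by blast
  then have "O_pow 0 (\<lambda>t. F (E t u))" by (rule O_pow_0_isCont)
  moreover have "((\<lambda>t. E t u - u) has_vector_derivative F (E s u)) (at s)" for s
    using has_vector_derivative_diff_const[of "\<lambda>t. E t u"] E_derivative by blast
  ultimately show ?thesis
    using O_pow_of_derivative[of "\<lambda>t. E t u - u" 1 "\<lambda>t. F (E t u)" 0] by (simp add: E_0)
qed

lemma F_along:
  assumes "O_pow 1 (\<lambda>t. c t - u)"
  shows "O_pow 1 (\<lambda>t. F (c t) - F u)"
proof -
  obtain r M where r: "0 < r" "0 \<le> M" "\<And>v w. norm (v - u) < r \<Longrightarrow> norm (w - u) < r \<Longrightarrow> norm (F v - F w) \<le> M * norm (v - w)"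
    using F_local[of u] by metis
  obtain d where d: "0 < d" "\<And>t. t \<noteq> 0 \<Longrightarrow> \<bar>t\<bar> < d \<Longrightarrow> norm (c t - u) < r"
    using O_pow_eventually_small[of 0] assms r(1) by (metis One_nat_def)
  show ?thesis
    by (rule O_pow_dominated[OF d(1) assms _ r(2)]) (use r d in auto)
qed

lemma F_along_velocity:
  assumes "O_pow 2 (\<lambda>t. c t - u - t *\<^sub>R w)"
  shows "O_pow 2 (\<lambda>t. F (c t) - F u - t *\<^sub>R DF 1 u [w])"
proof -
  obtain r M where r: "0 < r" "0 \<le> M" "\<And>v w. norm (v - u) < r \<Longrightarrow> norm (w - u) < r \<Longrightarrow>
       norm (F v - F w - DF 1 w [v - w]) \<le> M * (norm (v - w))\<^sup>2"
    using F_local[of u] by metis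
  note c1 = O_pow_1_of_velocity[OF assms]
  obtain d where d: "0 < d" "\<And>t. t \<noteq> 0 \<Longrightarrow> \<bar>t\<bar> < d \<Longrightarrow> norm (c t - u) < r"
    using O_pow_eventually_small[of 0] c1 r(1) by (metis One_nat_def)
  have "O_pow (1 + 1) (\<lambda>t. F (c t) - F u - DF 1 u [c t - u])"
    by (rule O_pow_mult_dominated[OF c1 c1 d(1) r(2)])
       (use r d in \<open>auto simp: power2_eq_square mult.assoc\<close>)
  moreover have "O_pow 2 (\<lambda>t. DF 1 u [c t - u - t *\<^sub>R w])"
    using frechet_derivatives_bounded_linear[OF derivatives_F UNIV_I, of "[]" "[]" 1 u]
    by (intro O_pow_bounded_linear[OF _ assms, of "\<lambda>h. DF 1 u [h]"]) simp
  ultimately have "O_pow 2 (\<lambda>t. (F (c t) - F u - DF 1 u [c t - u]) + DF 1 u [c t - u - t *\<^sub>R w])"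
    by (intro O_pow_add) (simp_all add: numeral_2_eq_2)
  moreover have "DF 1 u [c t - u - t *\<^sub>R w] = DF 1 u [c t - u] - t *\<^sub>R DF 1 u [w]" for t
    using DF_linear(2)[of "[]" "[]" 1 u "c t - u" "t *\<^sub>R w"] DF_linear(3)[of "[]" "[]" 1 u t w] by simp
  ultimately show ?thesis by simp
qed

lemma E_expansion: "O_pow 2 (\<lambda>t. E t u - u - t *\<^sub>R F u)"
proof -
  have "((\<lambda>t. E t u - u - t *\<^sub>R F u) has_vector_derivative F (E s u) - F u) (at s)" for s
  proof -
    have "((\<lambda>t. t *\<^sub>R F u) has_vector_derivative F u) (at s)"
      using has_vector_derivative_scaleR[of "\<lambda>t. t" 1 s UNIV "\<lambda>_. F u" 0] by simp
    then show ?thesis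
      using has_vector_derivative_diff[OF has_vector_derivative_diff[OF E_derivative has_vector_derivative_const]]
      by fastforce
  qed
  then show ?thesis
    using O_pow_of_derivative[of "\<lambda>t. E t u - u - t *\<^sub>R F u" 1 "\<lambda>s. F (E s u) - F u" 1] F_along[OF E_minus_initial[of u]]
    by (simp add: E_0 numeral_2_eq_2)
qed

definition codefect_coeff :: "nat \<Rightarrow> 'a \<Rightarrow> 'a" where
  "codefect_coeff j v = (1 / fact j) *\<^sub>R codefect j 0 v"

text \<open>The derivative of \<open>codefect_coeff j\<close> at \<open>u\<close> in the direction \<open>F u\<close>, by the product rule: one term from
the base point, one from the direction \<open>(1, - F v)\<close>.\<close>

definition codefect_coeff_deriv :: "nat \<Rightarrow> 'a \<Rightarrow> 'a" where
  "codefect_coeff_deriv j u = (1 / fact j) *\<^sub>R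
     (D (Suc (Suc j)) (0, u) ((0, F u) # replicate j (1, 0) @ [(1, - F u)])
      + D (Suc j) (0, u) (replicate j (1, 0) @ [(0, - DF 1 u [F u])]))"

lemma codefect_coeff_along:
  assumes "O_pow 1 (\<lambda>t. c t - u)"
  shows "O_pow 1 (\<lambda>t. codefect_coeff j (c t) - codefect_coeff j u)"
proof -
  obtain r M where r: "0 < r" "0 \<le> M" 
    "\<And>t v w. \<bar>t\<bar> < r \<Longrightarrow> norm (v - u) < r \<Longrightarrow> norm (w - u) < r \<Longrightarrow> norm (codefect j t v - codefect j t w) \<le> M * norm (v - w)"
    using codefect_local[of u j] by metis
  obtain d where d: "0 < d" "\<And>t. t \<noteq> 0 \<Longrightarrow> \<bar>t\<bar> < d \<Longrightarrow> norm (c t - u) < r"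
    using O_pow_eventually_small[of 0] assms r(1) by (metis One_nat_def)
  have "O_pow 1 (\<lambda>t. codefect j 0 (c t) - codefect j 0 u)"
    by (rule O_pow_dominated[OF d(1) assms _ r(2)]) (use r d in auto)
  from O_pow_scaleR[OF this, of "1 / fact j"] show ?thesis
    by (simp add: codefect_coeff_def scaleR_diff_right)
qed

text \<open>Along a curve through \<open>u\<close> with velocity \<open>F u\<close>, in particular along both the exact and the numerical
solution, a Taylor coefficient of the codefect changes by \<open>t\<close> times its derivative along \<open>F\<close>. The error has
to be \<open>O(t^2)\<close>, not only \<open>o(t)\<close>, for the final error to be \<open>O(t^(p+3))\<close>.\<close>

lemma codefect_coeff_along_velocity:
  assumes c2: "O_pow 2 (\<lambda>t. c t - u - t *\<^sub>R F u)"
  shows "O_pow 2 (\<lambda>t. codefect_coeff j (c t) - codefect_coeff j u - t *\<^sub>R codefect_coeff_deriv j u)"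
proof -
  let ?e = "replicate j (1::real, 0::'a)" and ?f = "\<lambda>v. (1::real, - F v)"
  let ?D = "\<lambda>v vs. D (Suc j) (0, v) vs" and ?D' = "D (Suc (Suc j)) (0, u)"
  obtain r M where r: "0 < r" "0 \<le> M"
    "\<And>s v t w vs. \<bar>s\<bar> < r \<Longrightarrow> norm (v - u) < r \<Longrightarrow> \<bar>t\<bar> < r \<Longrightarrow> norm (w - u) < r \<Longrightarrow> length vs = Suc j \<Longrightarrow>
       norm (D (Suc j) (s, v) vs - D (Suc j) (t, w) vs - D (Suc (Suc j)) (t, w) ((s - t, v - w) # vs))
         \<le> M * (norm (s - t, v - w))\<^sup>2 * list_norm vs"
    using D_local[of u "Suc j"] by metis
  obtain rF MF where F: "0 < rF" "0 \<le> MF" "\<And>v. norm (v - u) < rF \<Longrightarrow> norm (F v) \<le> MF"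
    using F_local[of u] by metis
  obtain r' M' where r': "0 < r'" "0 \<le> M'"
    "\<And>t v vs. \<bar>t\<bar> < r' \<Longrightarrow> norm (v - u) < r' \<Longrightarrow> length vs = Suc (Suc j) \<Longrightarrow>
       norm (D (Suc (Suc j)) (t, v) vs) \<le> M' * list_norm vs"
    using D_local[of u "Suc (Suc j)"] by metis
  note c1 = O_pow_1_of_velocity[OF c2]
  obtain d where d: "0 < d" "\<And>t. t \<noteq> 0 \<Longrightarrow> \<bar>t\<bar> < d \<Longrightarrow> norm (c t - u) < min r rF"
    using O_pow_eventually_small[of 0 "\<lambda>t. c t - u" "min r rF"] c1 r(1) F(1) by (metis One_nat_def min_less_iff_conj)
  have lin: "\<bar>0::real\<bar> < T" using T_pos by simp
  have 1: "O_pow (1 + 1) (\<lambda>t. ?D (c t) (?e @ [?f (c t)]) - ?D u (?e @ [?f (c t)]) - ?D' ((0, c t - u) # ?e @ [?f (c t)]))"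
  proof (rule O_pow_mult_dominated[OF c1 c1 d(1)])
    fix t :: real assume t: "t \<noteq> 0" "\<bar>t\<bar> < d"
    have "norm (?D (c t) (?e @ [?f (c t)]) - ?D u (?e @ [?f (c t)]) - ?D' ((0, c t - u) # ?e @ [?f (c t)]))
        \<le> (M * (norm (c t - u))\<^sup>2) * norm (?f (c t))"
      using r(3)[of 0 "c t" 0 u "?e @ [?f (c t)]"] d(2)[OF t] r(1) by simp
    also have "\<dots> \<le> (M * (norm (c t - u))\<^sup>2) * (1 + MF)"
      using norm_Pair_le[of "1::real" "- F (c t)"] F(3)[of "c t"] d(2)[OF t] r(2)
      by (intro mult_left_mono) auto
    finally show "norm (?D (c t) (?e @ [?f (c t)]) - ?D u (?e @ [?f (c t)]) - ?D' ((0, c t - u) # ?e @ [?f (c t)]))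
        \<le> M * (1 + MF) * norm (c t - u) * norm (c t - u)"
      by (simp add: power2_eq_square mult_ac)
  qed (use r F in simp)
  have 2: "O_pow (1 + 1) (\<lambda>t. ?D' ((0, c t - u) # ?e @ [(0, - (F (c t) - F u))]))"
  proof (rule O_pow_mult_dominated[OF c1 F_along[OF c1] d(1) r'(2)])
    fix t :: real
    show "norm (?D' ((0, c t - u) # ?e @ [(0, - (F (c t) - F u))])) \<le> M' * norm (c t - u) * norm (F (c t) - F u)"
      using r'(3)[of 0 u "(0, c t - u) # ?e @ [(0, - (F (c t) - F u))]"] r'(1) 
      by (simp add: mult.assoc norm_minus_commute)
  qed
  have 3: "O_pow 2 (\<lambda>t. ?D' ((0, c t - u - t *\<^sub>R F u) # ?e @ [?f u]))"
  proof (rule O_pow_bounded_linear[OF _ c2, of "\<lambda>h. ?D' ((0, h) # ?e @ [?f u])"])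
    show "bounded_linear (\<lambda>h. ?D' ((0, h) # ?e @ [?f u]))"
      using bounded_linear_compose[OF D_bounded_linear[OF lin, of "[]" "?e @ [?f u]" "Suc (Suc j)" u]
          bounded_linear_Pair[OF bounded_linear_zero bounded_linear_ident]] by simp
  qed
  have 4: "O_pow 2 (\<lambda>t. - ?D u (?e @ [(0, F (c t) - F u - t *\<^sub>R DF 1 u [F u])]))"
  proof (rule O_pow_minus, rule O_pow_bounded_linear[OF _ F_along_velocity[OF c2], of "\<lambda>h. ?D u (?e @ [(0, h)])"])
    show "bounded_linear (\<lambda>h. ?D u (?e @ [(0, h)]))"
      using bounded_linear_compose[OF D_bounded_linear[OF lin, of "?e" "[]" "Suc j" u]
          bounded_linear_Pair[OF bounded_linear_zero bounded_linear_ident]] by simp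
  qed
  have eq: "codefect j 0 (c t) - codefect j 0 u - t *\<^sub>R (?D' ((0, F u) # ?e @ [?f u]) + ?D u (?e @ [(0, - DF 1 u [F u])]))
     = (?D (c t) (?e @ [?f (c t)]) - ?D u (?e @ [?f (c t)]) - ?D' ((0, c t - u) # ?e @ [?f (c t)]))
       + ?D' ((0, c t - u) # ?e @ [(0, - (F (c t) - F u))])
       + ?D' ((0, c t - u - t *\<^sub>R F u) # ?e @ [?f u])
       + - ?D u (?e @ [(0, F (c t) - F u - t *\<^sub>R DF 1 u [F u])])" for t
  proof -
    have e1: "?D' ((0, c t - u) # ?e @ [(0, - (F (c t) - F u))])
        = ?D' ((0, c t - u) # ?e @ [?f (c t)]) - ?D' ((0, c t - u) # ?e @ [?f u])"
      using D_linear(2)[OF lin, of "(0, c t - u) # ?e" "[]" "Suc (Suc j)" u "?f (c t)" "?f u"] by simp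
    have e2: "?D' ((0, c t - u - t *\<^sub>R F u) # ?e @ [?f u])
        = ?D' ((0, c t - u) # ?e @ [?f u]) - t *\<^sub>R ?D' ((0, F u) # ?e @ [?f u])"
      using D_linear(2)[OF lin, of "[]" "?e @ [?f u]" "Suc (Suc j)" u "(0, c t - u)" "t *\<^sub>R (0, F u)"]
        D_linear(3)[OF lin, of "[]" "?e @ [?f u]" "Suc (Suc j)" u t "(0, F u)"] by simp
    have e3: "?D u (?e @ [(0, F (c t) - F u - t *\<^sub>R DF 1 u [F u])])
        = ?D u (?e @ [?f u]) - ?D u (?e @ [?f (c t)]) + t *\<^sub>R ?D u (?e @ [(0, - DF 1 u [F u])])"
      using D_linear(1)[OF lin, of ?e "[]" "Suc j" u "?f u - ?f (c t)" "t *\<^sub>R (0, - DF 1 u [F u])"]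
        D_linear(2)[OF lin, of ?e "[]" "Suc j" u "?f u" "?f (c t)"]
        D_linear(3)[OF lin, of ?e "[]" "Suc j" u t "(0, - DF 1 u [F u])"] by simp
    show ?thesis unfolding codefect_def e1 e2 e3 by (simp add: algebra_simps)
  qed
  have "O_pow 2 (\<lambda>t. codefect j 0 (c t) - codefect j 0 u - t *\<^sub>R (?D' ((0, F u) # ?e @ [?f u]) + ?D u (?e @ [(0, - DF 1 u [F u])])))"
    unfolding eq using 1 2 by (intro O_pow_add 3 4) (simp_all only: one_add_one)
  from O_pow_scaleR[OF this, of "1 / fact j"] show ?thesis
    by (simp add: codefect_coeff_def codefect_coeff_deriv_def scaleR_diff_right)
qed

text \<open>The remainder is uniform in the initial value, which is what allows an argument that moves
with \<open>t\<close> to be inserted.\<close>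

lemma codefect_taylor:
  assumes "\<And>j v. j < m \<Longrightarrow> codefect_coeff j v = 0"
  obtains r M where "0 < r" "r \<le> T" "0 \<le> M"
    "\<And>t v. \<bar>t\<bar> < r \<Longrightarrow> norm (v - u) < r \<Longrightarrow>
       norm (codefect 0 t v - t ^ m *\<^sub>R codefect_coeff m v - t ^ Suc m *\<^sub>R codefect_coeff (Suc m) v) \<le> M * \<bar>t\<bar> ^ (m + 2)"
proof -
  obtain r M where r: "0 < r" "r \<le> T" "0 \<le> M"
    "\<And>t v. \<bar>t\<bar> < r \<Longrightarrow> norm (v - u) < r \<Longrightarrow> norm (codefect (m + 2) t v) \<le> M"
    using codefect_local[of u "m + 2"] by metis
  have "norm (codefect 0 t v - t ^ m *\<^sub>R codefect_coeff m v - t ^ Suc m *\<^sub>R codefect_coeff (Suc m) v) \<le> M * \<bar>t\<bar> ^ (m + 2)"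
    if "\<bar>t\<bar> < r" "norm (v - u) < r" for t v
  proof -
    have "(\<Sum>j<m + 2. (t ^ j / fact j) *\<^sub>R codefect j 0 v) = (\<Sum>j<m + 2. t ^ j *\<^sub>R codefect_coeff j v)"
      by (simp add: codefect_coeff_def)
    also have "\<dots> = t ^ m *\<^sub>R codefect_coeff m v + t ^ Suc m *\<^sub>R codefect_coeff (Suc m) v"
      using assms by simp
    finally show ?thesis
      using taylor_remainder_bound[of r "\<lambda>j t. codefect j t v" "m + 2" M t] r that codefect_has_derivative
      by (simp add: algebra_simps)
  qed
  with r show thesis using that by blast
qed

text \<open>The difference \<open>S(t,u) - E(t,u)\<close> is the integral of \<open>B(t - s, E(s,u))\<close> over \<open>[0,t]\<close>, and the integrand is
known up to \<open>O(t^(m+2))\<close>. The number \<open>m\<close> is arbitrary, so that the lemma serves both to detect the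
leading coefficient and, with \<open>m = p\<close>, to compute the next one.\<close>

lemma scheme_minus_flow_expansion_backward:
  assumes codefect_coeff_0: "\<And>j v. j < m \<Longrightarrow> codefect_coeff j v = 0"
  shows "O_pow (m + 3) (\<lambda>t. S t u - E t u
      - (t ^ Suc m / Suc m) *\<^sub>R (codefect_coeff m u + t *\<^sub>R codefect_coeff_deriv m u)
      - (t ^ (m + 2) / (m + 2)) *\<^sub>R (codefect_coeff (Suc m) u - codefect_coeff_deriv m u))"
proof -
  let ?b = "codefect_coeff m u" and ?b' = "codefect_coeff_deriv m u" and ?g = "codefect_coeff (Suc m) u"
  obtain r M where r: "0 < r" "r \<le> T" "0 \<le> M"
    "\<And>t v. \<bar>t\<bar> < r \<Longrightarrow> norm (v - u) < r \<Longrightarrow>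
       norm (codefect 0 t v - t ^ m *\<^sub>R codefect_coeff m v - t ^ Suc m *\<^sub>R codefect_coeff (Suc m) v) \<le> M * \<bar>t\<bar> ^ (m + 2)"
    using codefect_taylor[OF codefect_coeff_0] by metis
  obtain d1 K1 where 1: "0 < d1" "0 \<le> K1" "\<And>s. s \<noteq> 0 \<Longrightarrow> \<bar>s\<bar> < d1 \<Longrightarrow>
      norm (codefect_coeff m (E s u) - ?b - s *\<^sub>R ?b') \<le> K1 * \<bar>s\<bar> ^ 2"
    using O_powE[OF codefect_coeff_along_velocity[OF E_expansion[of u], of m]] by metis
  obtain d2 K2 where 2: "0 < d2" "0 \<le> K2" "\<And>s. s \<noteq> 0 \<Longrightarrow> \<bar>s\<bar> < d2 \<Longrightarrow>
      norm (codefect_coeff (Suc m) (E s u) - ?g) \<le> K2 * \<bar>s\<bar> ^ 1"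
    using O_powE[OF codefect_coeff_along[OF E_minus_initial[of u], of "Suc m"]] by metis
  obtain d3 where 3: "0 < d3" "\<And>s. s \<noteq> 0 \<Longrightarrow> \<bar>s\<bar> < d3 \<Longrightarrow> norm (E s u - u) < r"
    using O_pow_eventually_small[of 0 "\<lambda>t. E t u - u" r] E_minus_initial[of u] r(1) by (metis One_nat_def)
  define d where "d = min (min d1 d2) (min d3 (r / 2))"
  define K where "K = (M * 2 ^ (m + 2) + 2 ^ m * K1 + 2 ^ Suc m * K2)"
  show ?thesis
  proof (rule O_powI)
    show "0 < d" using 1 2 3 r by (simp add: d_def)
    fix t :: real assume t: "\<bar>t\<bar> < d"
    \<comment> \<open>\<open>Q\<close> is the antiderivative in \<open>s\<close>, with \<open>Q t = 0\<close>, of the expected main part \<open>q\<close> of \<open>B(t - s, E(s,u))\<close>; here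
  \<open>s = t - (t - s)\<close> has been used to write \<open>(t - s)^m s\<close> through powers of \<open>t - s\<close>.\<close>
    define Q where "Q s = - ((t - s) ^ Suc m / Suc m) *\<^sub>R (?b + t *\<^sub>R ?b') - ((t - s) ^ (m + 2) / (m + 2)) *\<^sub>R (?g - ?b')" for s
    define q where "q s = (t - s) ^ m *\<^sub>R (?b + t *\<^sub>R ?b') + (t - s) ^ Suc m *\<^sub>R (?g - ?b')" for s
    have "norm ((S (t - t) (E t u) + Q t) - (S (t - 0) (E 0 u) + Q 0)) \<le> K * \<bar>t\<bar> ^ (m + 2) * \<bar>t\<bar>"
    proof (rule norm_increment_le)
      fix s :: real assume s: "\<bar>s\<bar> \<le> \<bar>t\<bar>"
      have ts: "\<bar>t - s\<bar> < T" "\<bar>t - s\<bar> < r" "\<bar>t - s\<bar> \<le> 2 * \<bar>t\<bar>" using s t r by (auto simp: d_def)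
      have "((\<lambda>s. (t - s, E s u)) has_derivative (\<lambda>h. (- h, h *\<^sub>R F (E s u)))) (at s)"
        using E_derivative[of u s] unfolding has_vector_derivative_def
        by (auto intro!: derivative_eq_intros)
      from has_derivative_compose[OF this S_has_derivative[OF ts(1)]]
      have "((\<lambda>s. S (t - s) (E s u)) has_derivative (\<lambda>h. D 1 (t - s, E s u) [(- h, h *\<^sub>R F (E s u))])) (at s)"
        by simp
      moreover have "D 1 (t - s, E s u) [(- h, h *\<^sub>R F (E s u))] = h *\<^sub>R - codefect 0 (t - s) (E s u)" for h
        using D_linear(3)[OF ts(1), of "[]" "[]" 1 "E s u" "- h" "(1, - F (E s u))"] by (simp add: codefect_def)
      ultimately have "((\<lambda>s. S (t - s) (E s u)) has_vector_derivative - codefect 0 (t - s) (E s u)) (at s)"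
        unfolding has_vector_derivative_def by simp
      moreover have pow: "((\<lambda>s. - ((t - s) ^ Suc n / Suc n) *\<^sub>R c) has_vector_derivative (t - s) ^ n *\<^sub>R c) (at s)" for n and c :: 'a
      proof -
        have "((\<lambda>s. - ((t - s) ^ Suc n / Suc n)) has_real_derivative (t - s) ^ n) (at s)"
          by (auto intro!: derivative_eq_intros simp del: power_Suc of_nat_Suc)
        then show ?thesis
          using has_vector_derivative_scaleR[of "\<lambda>s. - ((t - s) ^ Suc n / Suc n)" _ s UNIV "\<lambda>_. c" 0] by simp
      qed
      have "(Q has_vector_derivative q s) (at s)"
        using has_vector_derivative_add[OF pow[of m "?b + t *\<^sub>R ?b'"] pow[of "Suc m" "?g - ?b'"]]
        unfolding Q_def q_def by simp
      ultimately show "((\<lambda>s. S (t - s) (E s u) + Q s) has_vector_derivative - codefect 0 (t - s) (E s u) + q s) (at s)"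
        by (intro has_vector_derivative_add)
      assume s0: "s \<noteq> 0"
      have "- codefect 0 (t - s) (E s u) + q s
        = - (codefect 0 (t - s) (E s u) - (t - s) ^ m *\<^sub>R codefect_coeff m (E s u) - (t - s) ^ Suc m *\<^sub>R codefect_coeff (Suc m) (E s u))
          - (t - s) ^ m *\<^sub>R (codefect_coeff m (E s u) - ?b - s *\<^sub>R ?b')
          - (t - s) ^ Suc m *\<^sub>R (codefect_coeff (Suc m) (E s u) - ?g)"
        by (simp add: q_def algebra_simps)
      also have "norm \<dots> \<le> M * (2 * \<bar>t\<bar>) ^ (m + 2) + (2 * \<bar>t\<bar>) ^ m * (K1 * \<bar>t\<bar> ^ 2) + (2 * \<bar>t\<bar>) ^ Suc m * (K2 * \<bar>t\<bar>)"
      proof (intro order.trans[OF norm_triangle_ineq4 add_mono])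
        have "norm (E s u - u) < r" using 3(2)[OF s0] s t by (simp add: d_def)
        then have "norm (codefect 0 (t - s) (E s u) - (t - s) ^ m *\<^sub>R codefect_coeff m (E s u) - (t - s) ^ Suc m *\<^sub>R codefect_coeff (Suc m) (E s u))
            \<le> M * \<bar>t - s\<bar> ^ (m + 2)" using r(4) ts by blast
        also have "\<dots> \<le> M * (2 * \<bar>t\<bar>) ^ (m + 2)" using ts r(3) by (intro mult_left_mono power_mono) auto
        finally show "norm (- (codefect 0 (t - s) (E s u) - (t - s) ^ m *\<^sub>R codefect_coeff m (E s u) - (t - s) ^ Suc m *\<^sub>R codefect_coeff (Suc m) (E s u)))
            \<le> M * (2 * \<bar>t\<bar>) ^ (m + 2)" by (simp only: norm_minus_cancel)
        have "norm (codefect_coeff m (E s u) - ?b - s *\<^sub>R ?b') \<le> K1 * \<bar>s\<bar> ^ 2" using 1(3)[OF s0] s t by (simp add: d_def)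
        also have "\<dots> \<le> K1 * \<bar>t\<bar> ^ 2" using s 1(2) by (intro mult_left_mono power_mono) auto
        finally show "norm ((t - s) ^ m *\<^sub>R (codefect_coeff m (E s u) - ?b - s *\<^sub>R ?b')) \<le> (2 * \<bar>t\<bar>) ^ m * (K1 * \<bar>t\<bar> ^ 2)"
          unfolding norm_scaleR real_norm_def power_abs using ts by (intro mult_mono power_mono) auto
        have "norm (codefect_coeff (Suc m) (E s u) - ?g) \<le> K2 * \<bar>s\<bar>" using 2(3)[OF s0] s t by (simp add: d_def)
        also have "\<dots> \<le> K2 * \<bar>t\<bar>" using s 2(2) by (intro mult_left_mono) auto
        finally show "norm ((t - s) ^ Suc m *\<^sub>R (codefect_coeff (Suc m) (E s u) - ?g)) \<le> (2 * \<bar>t\<bar>) ^ Suc m * (K2 * \<bar>t\<bar>)"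
          unfolding norm_scaleR real_norm_def power_abs using ts by (intro mult_mono power_mono) auto
      qed
      also have "\<dots> = K * \<bar>t\<bar> ^ (m + 2)"
        by (simp add: K_def algebra_simps power2_eq_square)
      finally show "norm (- codefect 0 (t - s) (E s u) + q s) \<le> K * \<bar>t\<bar> ^ (m + 2)" .
    qed
    moreover have "(S (t - t) (E t u) + Q t) - (S (t - 0) (E 0 u) + Q 0) = - (S t u - E t u
      - (t ^ Suc m / Suc m) *\<^sub>R (?b + t *\<^sub>R ?b') - (t ^ (m + 2) / (m + 2)) *\<^sub>R (?g - ?b'))"
      by (simp add: Q_def S_0 E_0)
    ultimately show "norm (S t u - E t u
      - (t ^ Suc m / Suc m) *\<^sub>R (?b + t *\<^sub>R ?b') - (t ^ (m + 2) / (m + 2)) *\<^sub>R (?g - ?b')) \<le> K * \<bar>t\<bar> ^ (m + 3)"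
      by (simp only: norm_minus_cancel) (simp add: numeral_3_eq_3 mult_ac)
  qed
qed

text \<open>Order \<open>p\<close> is a condition on each trajectory separately. The conclusion holds for all \<open>u\<close> at once, and
together with \<open>codefect_taylor\<close> it makes the defects \<open>O(t^p)\<close> locally uniformly. If the coefficients below
degree \<open>m\<close> vanish, the leading term of \<open>S - E\<close> is \<open>t^(m+1)/(m+1)\<close> times the coefficient of degree \<open>m\<close>,
which must therefore vanish as long as \<open>m < p\<close>.\<close>

lemma codefect_coeff_eq_0:
  assumes "has_order S E p" "j < p"
  shows "codefect_coeff j u = 0"
  using assms(2)
proof (induction j arbitrary: u rule: less_induct)
  case (less m)
  let ?c = "codefect_coeff_deriv m u" and ?g = "codefect_coeff (Suc m) u"
  have L: "O_pow (m + 3) (\<lambda>t. S t u - E t u - (t ^ Suc m / Suc m) *\<^sub>R (codefect_coeff m u + t *\<^sub>R ?c)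
      - (t ^ (m + 2) / (m + 2)) *\<^sub>R (?g - ?c))"
    using less.IH less.prems by (intro scheme_minus_flow_expansion_backward) auto
  have "O_pow (p + 1) (\<lambda>t. S t u - E t u)"
    using assms(1) unfolding has_order_def O_pow_def by blast
  then have order: "O_pow (m + 2) (\<lambda>t. S t u - E t u)"
    by (rule O_pow_mono) (use less.prems in simp)
  have L': "O_pow (m + 2) (\<lambda>t. S t u - E t u - (t ^ Suc m / Suc m) *\<^sub>R (codefect_coeff m u + t *\<^sub>R ?c)
      - (t ^ (m + 2) / (m + 2)) *\<^sub>R (?g - ?c))"
    by (rule O_pow_mono[OF L]) simp
  have "O_pow (m + 2) (\<lambda>t. (S t u - E t u)
      - (S t u - E t u - (t ^ Suc m / Suc m) *\<^sub>R (codefect_coeff m u + t *\<^sub>R ?c) - (t ^ (m + 2) / (m + 2)) *\<^sub>R (?g - ?c))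
      - t ^ (m + 2) *\<^sub>R ((1 / Suc m) *\<^sub>R ?c + (1 / (m + 2)) *\<^sub>R (?g - ?c)))"
    by (rule O_pow_diff[OF O_pow_diff[OF order L'] O_pow_power])
  moreover have "x - (x - (t ^ Suc m / Suc m) *\<^sub>R (codefect_coeff m u + t *\<^sub>R ?c) - (t ^ (m + 2) / (m + 2)) *\<^sub>R (?g - ?c))
      - t ^ (m + 2) *\<^sub>R ((1 / Suc m) *\<^sub>R ?c + (1 / (m + 2)) *\<^sub>R (?g - ?c))
      = t ^ Suc m *\<^sub>R ((1 / Suc m) *\<^sub>R codefect_coeff m u)" for t x
  proof -
    have "(t ^ Suc m / Suc m) *\<^sub>R (t *\<^sub>R ?c) = t ^ (m + 2) *\<^sub>R ((1 / Suc m) *\<^sub>R ?c)"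
      by (simp add: mult_ac)
    then show ?thesis by (simp add: scaleR_add_right del: power_Suc of_nat_Suc)
  qed
  ultimately have "O_pow (Suc (Suc m)) (\<lambda>t. t ^ Suc m *\<^sub>R ((1 / Suc m) *\<^sub>R codefect_coeff m u))"
    by (simp only: add_2_eq_Suc')
  from O_pow_power_coefficient_0[OF this] show ?case by simp
qed

end

section \<open>Self-adjoint schemes and the corrected scheme\<close>

locale self_adjoint_scheme_and_flow = scheme_and_flow +
  fixes p :: nat
  assumes self_adjoint: "self_adjoint T S" and order: "has_order S E p"
    and even_p: "even p" and p_ge_2: "p \<ge> 2"
begin

abbreviation transport :: "real \<Rightarrow> 'a \<Rightarrow> 'a \<Rightarrow> 'a" where
  "transport t u w \<equiv> D 1 (t, u) [(0, w)]"

abbreviation defect :: "real \<Rightarrow> 'a \<Rightarrow> 'a" where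
  "defect t u \<equiv> D 1 (t, u) [(1, 0)] - F (S t u)"

abbreviation sym_defect :: "real \<Rightarrow> 'a \<Rightarrow> 'a" where
  "sym_defect \<equiv> symmetrized_defect F S"

lemma S_reverse: "\<bar>t\<bar> < T \<Longrightarrow> S (- t) (S t u) = u"
  using self_adjoint unfolding self_adjoint_def by blast

lemma codefect_coeff_0: "j < p \<Longrightarrow> codefect_coeff j u = 0"
  using codefect_coeff_eq_0[OF order] .

lemma codefect_eq: "\<bar>t\<bar> < T \<Longrightarrow> codefect 0 t v = D 1 (t, v) [(1, 0)] - transport t v (F v)"
  using D_linear(2)[of t "[]" "[]" 1 v "(1, 0)" "(0, F v)"] by (simp add: codefect_def)

lemma transport_bounded_linear:
  assumes "\<bar>t\<bar> < T"
  shows "bounded_linear (transport t u)"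
  using bounded_linear_compose[OF D_bounded_linear[OF assms, of "[]" "[]" 1 u]
      bounded_linear_Pair[OF bounded_linear_zero bounded_linear_ident]] by simp

lemma DF_bounded_linear: "bounded_linear (\<lambda>h. DF 1 u [h])"
  using frechet_derivatives_bounded_linear[OF derivatives_F UNIV_I, of "[]" "[]" 1 u] by simp

text \<open>The chain rule for \<open>S(t, S(-t, w)) = w\<close>, differentiated in the direction \<open>(s, h)\<close> at \<open>w = S(t,u)\<close>. The
choice \<open>s = 0\<close> gives the inverse of \<open>d2 S\<close>, and \<open>(s, h) = (1, F w)\<close> relates defect and codefect.\<close>

lemma derivative_of_reversal:
  assumes t: "\<bar>t\<bar> < T"
  shows "D 1 (t, u) [(s, D 1 (- t, S t u) [(- s, h)])] = h"
proof -
  let ?w = "S t u"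
  have t': "\<bar>- t\<bar> < T" using t by simp
  have "((\<lambda>x. (- fst x, snd x)) has_derivative (\<lambda>h. (- fst h, snd h))) (at (t, ?w))"
    by (intro derivative_intros)
  from has_derivative_compose[OF this, of "\<lambda>(t, u). S t u" "\<lambda>h. D 1 (- t, ?w) [h]"]
  have "((\<lambda>x. S (- fst x) (snd x)) has_derivative (\<lambda>h. D 1 (- t, ?w) [(- fst h, snd h)])) (at (t, ?w))"
    using S_has_derivative[OF t', of ?w] by simp
  from has_derivative_Pair[OF has_derivative_fst[OF has_derivative_ident] this]
  have "((\<lambda>x. (fst x, S (- fst x) (snd x))) has_derivative
      (\<lambda>h. (fst h, D 1 (- t, ?w) [(- fst h, snd h)]))) (at (t, ?w))" by simp
  from has_derivative_compose[OF this, of "\<lambda>(t, u). S t u" "\<lambda>h. D 1 (t, u) [h]"]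
  have "((\<lambda>x. S (fst x) (S (- fst x) (snd x))) has_derivative
      (\<lambda>h. D 1 (t, u) [(fst h, D 1 (- t, ?w) [(- fst h, snd h)])])) (at (t, ?w))"
    using S_has_derivative[OF t, of u] S_reverse[OF t, of u] by simp
  then have "(snd has_derivative
      (\<lambda>h. D 1 (t, u) [(fst h, D 1 (- t, ?w) [(- fst h, snd h)])])) (at (t, ?w))"
  proof (rule has_derivative_transform_within_open)
    show "open ({-T<..<T} \<times> (UNIV :: 'a set))" by (intro open_Times) auto
    show "(t, ?w) \<in> {-T<..<T} \<times> UNIV" by (rule in_domain[OF t])
    show "S (fst x) (S (- fst x) (snd x)) = snd x" if "x \<in> {-T<..<T} \<times> UNIV" for x
      using S_reverse[of "- fst x" "snd x"] that by (auto simp: abs_less_iff)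
  qed
  from has_derivative_unique[OF this has_derivative_snd[OF has_derivative_ident]]
  have "(\<lambda>h. D 1 (t, u) [(fst h, D 1 (- t, ?w) [(- fst h, snd h)])]) = snd" .
  from fun_cong[OF this, of "(s, h)"] show ?thesis by simp
qed

lemma transport_inverse: "\<bar>t\<bar> < T \<Longrightarrow> transport t u (transport (- t) (S t u) h) = h"
  using derivative_of_reversal[of t u 0 h] by simp

lemma transport_inverse': "\<bar>t\<bar> < T \<Longrightarrow> transport (- t) (S t u) (transport t u h) = h"
  using transport_inverse[of "- t" "S t u" h] by (simp add: S_reverse)

lemma defect_eq:
  assumes t: "\<bar>t\<bar> < T"
  shows "defect t u = transport t u (codefect 0 (- t) (S t u))"
proof -
  let ?w = "S t u" and ?z = "D 1 (- t, S t u) [(- 1, F (S t u))]"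
  have "?z = - codefect 0 (- t) ?w"
    using D_linear(4)[of "- t" "[]" "[]" 1 ?w "(1, - F ?w)"] t by (simp add: codefect_def)
  moreover have "D 1 (t, u) [(1, ?z)] = F ?w"
    by (rule derivative_of_reversal[OF t])
  moreover have "D 1 (t, u) [(1, ?z)] = D 1 (t, u) [(1, 0)] + transport t u ?z"
    using D_linear(1)[OF t, of "[]" "[]" 1 u "(1, 0)" "(0, ?z)"] by simp
  moreover have "transport t u (- codefect 0 (- t) ?w) = - transport t u (codefect 0 (- t) ?w)"
    using linear_neg[OF bounded_linear.linear[OF transport_bounded_linear[OF t, of u]]] .
  ultimately show ?thesis by (simp add: algebra_simps)
qed

lemma codefect_reverse_eq:
  assumes "\<bar>t\<bar> < T"
  shows "codefect 0 (- t) (S t u) = transport (- t) (S t u) (defect t u)"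
  using defect_eq[OF assms] transport_inverse'[OF assms] by simp

lemma sym_defect_eq:
  assumes t: "\<bar>t\<bar> < T"
  shows "sym_defect t u = (1 / 2) *\<^sub>R (defect t u + codefect 0 t u)"
proof -
  have "vector_derivative (\<lambda>s. S s u) (at t) = D 1 (t, u) [(1, 0)]"
    by (rule vector_derivative_at[OF S_has_time_derivative[OF t]])
  moreover have "frechet_derivative (\<lambda>v. S t v) (at u) = transport t u"
    using frechet_derivative_at[OF S_has_space_derivative[OF t]] by simp
  moreover have "x - (1 / 2) *\<^sub>R (a + b) = (1 / 2) *\<^sub>R (x - a + (x - b))" for x a b :: 'a
    by (simp add: algebra_simps flip: scaleR_2)
  ultimately show ?thesis
    unfolding symmetrized_defect_def codefect_eq[OF t] by simp
qed

text \<open>Reversal exchanges defect and codefect up to the linear map \<open>d2 S(-t, S(t,u))\<close>, so their mean is only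
transported by it. Neither of the two is covariant by itself in this way, hence the symmetrization.\<close>

lemma sym_defect_reverse:
  assumes t: "\<bar>t\<bar> < T"
  shows "sym_defect (- t) (S t u) = transport (- t) (S t u) (sym_defect t u)"
proof -
  have t': "\<bar>- t\<bar> < T" using t by simp
  interpret transport: bounded_linear "transport (- t) (S t u)" by (rule transport_bounded_linear[OF t'])
  have "defect (- t) (S t u) = transport (- t) (S t u) (codefect 0 t u)"
    using defect_eq[OF t', of "S t u"] by (simp add: S_reverse[OF t])
  then show ?thesis
    unfolding sym_defect_eq[OF t] sym_defect_eq[OF t'] transport.scaleR transport.add codefect_reverse_eq[OF t] by (simp add: add.commute)
qed

text \<open>Consistency of the scheme, valid at every \<open>v\<close> and hence differentiable in \<open>v\<close>.\<close>

lemma time_derivative_0: "D 1 (0, v) [(1, 0)] = F v"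
proof -
  have "codefect 0 0 v = 0" using codefect_coeff_0[of 0 v] p_ge_2 by (simp add: codefect_coeff_def)
  then show ?thesis using codefect_eq[of 0 v] T_pos D_1_space_0[of v "F v"] by simp
qed

text \<open>The identity \<open>d1 S(0,v) = F v\<close> can only be differentiated in \<open>v\<close>, which produces the mixed derivative in the
other order; symmetry exchanges the two directions.\<close>

lemma mixed_derivative_0: "D 2 (0, u) [(1, 0), (0, w)] = DF 1 u [w]"
proof -
  have dom: "(0, u) \<in> {-T<..<T} \<times> UNIV" using T_pos by simp
  have "((\<lambda>v. (0::real, v)) has_derivative (\<lambda>h. (0, h))) (at u)"
    by (auto intro!: derivative_eq_intros)
  from has_derivative_compose[OF this has_derivative_frechet_derivatives[OF derivatives_S dom, of "[(1, 0)]" 1]]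
  have "(F has_derivative (\<lambda>h. D 2 (0, u) [(0, h), (1, 0)])) (at u)"
    by (simp add: time_derivative_0[unfolded One_nat_def] numeral_2_eq_2)
  moreover have "(F has_derivative (\<lambda>h. DF 1 u [h])) (at u)"
    using has_derivative_frechet_derivatives[OF derivatives_F UNIV_I, of "[]" 0 u] by (simp add: DF_0)
  ultimately have "(\<lambda>h. D 2 (0, u) [(0, h), (1, 0)]) = (\<lambda>h. DF 1 u [h])"
    by (rule has_derivative_unique)
  from fun_cong[OF this, of w] show ?thesis
    using second_derivative_symmetric[OF derivatives_S dom] by metis
qed

lemma S_expansion: "O_pow 2 (\<lambda>t. S t u - u - t *\<^sub>R F u)"
proof -
  obtain r M where r: "0 < r" "r \<le> T" "0 \<le> M"
    "\<And>s v t w vs. \<bar>s\<bar> < r \<Longrightarrow> norm (v - u) < r \<Longrightarrow> \<bar>t\<bar> < r \<Longrightarrow> norm (w - u) < r \<Longrightarrow> length vs = 0 \<Longrightarrow>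
       norm (D 0 (s, v) vs - D 0 (t, w) vs - D (Suc 0) (t, w) ((s - t, v - w) # vs))
         \<le> M * (norm (s - t, v - w))\<^sup>2 * list_norm vs"
    using D_local[of u 0] by metis
  show ?thesis
  proof (rule O_powI[OF r(1)])
    fix t :: real assume t: "\<bar>t\<bar> < r"
    have "D 1 (0, u) [(t, 0)] = t *\<^sub>R F u"
      using D_linear(3)[of 0 "[]" "[]" 1 u t "(1, 0)"] T_pos time_derivative_0[of u] by simp
    then show "norm (S t u - u - t *\<^sub>R F u) \<le> M * \<bar>t\<bar> ^ 2"
      using r(4)[of t u 0 u "[]"] t r(1,2) T_pos by (simp add: D_0 S_0)
  qed
qed

text \<open>This is \<open>d2 S(t,u) = I + t F'(u) + O(t^2)\<close> in operator norm, applied to a vector that itself depends on \<open>t\<close>.\<close>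

lemma transport_along:
  assumes "O_pow n f"
  shows "O_pow (n + 2) (\<lambda>t. transport t u (f t) - f t - t *\<^sub>R DF 1 u [f t])"
proof -
  obtain r M where r: "0 < r" "r \<le> T" "0 \<le> M"
    "\<And>s v t w vs. \<bar>s\<bar> < r \<Longrightarrow> norm (v - u) < r \<Longrightarrow> \<bar>t\<bar> < r \<Longrightarrow> norm (w - u) < r \<Longrightarrow> length vs = 1 \<Longrightarrow>
       norm (D 1 (s, v) vs - D 1 (t, w) vs - D (Suc 1) (t, w) ((s - t, v - w) # vs))
         \<le> M * (norm (s - t, v - w))\<^sup>2 * list_norm vs"
    using D_local[of u 1] by metis
  have "O_pow (2 + n) (\<lambda>t. transport t u (f t) - f t - t *\<^sub>R DF 1 u [f t])"
  proof (rule O_pow_mult_dominated[OF O_pow_power[of 2 "1::real"] assms r(1,3)])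
    fix t :: real assume t: "\<bar>t\<bar> < r"
    have "D 2 (0, u) [(t, 0), (0, f t)] = t *\<^sub>R DF 1 u [f t]"
      using D_linear(3)[of 0 "[]" "[(0, f t)]" 2 u t "(1, 0)"] T_pos mixed_derivative_0[of u "f t"] by simp
    then show "norm (transport t u (f t) - f t - t *\<^sub>R DF 1 u [f t]) \<le> M * norm (t\<^sup>2 *\<^sub>R (1::real)) * norm (f t)"
      using r(4)[of t u 0 u "[(0, f t)]"] t r(1) D_1_space_0[of u "f t"] by (simp add: numeral_2_eq_2)
  qed
  then show ?thesis by (simp add: add.commute)
qed

lemma codefect_expansion: "O_pow (p + 2) (\<lambda>t. codefect 0 t u - t ^ p *\<^sub>R codefect_coeff p u - t ^ Suc p *\<^sub>R codefect_coeff (Suc p) u)"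
proof -
  obtain r M where r: "0 < r" "\<And>t v. \<bar>t\<bar> < r \<Longrightarrow> norm (v - u) < r \<Longrightarrow>
       norm (codefect 0 t v - t ^ p *\<^sub>R codefect_coeff p v - t ^ Suc p *\<^sub>R codefect_coeff (Suc p) v) \<le> M * \<bar>t\<bar> ^ (p + 2)"
    using codefect_taylor[OF codefect_coeff_0] by metis
  then show ?thesis by (intro O_powI[OF r(1), of _ M]) simp
qed

text \<open>The evenness of \<open>p\<close> enters here: it makes the leading term of \<open>B(-t,_)\<close> agree with that of \<open>B(t,_)\<close> and
reverses the sign of the next one. Moving the argument from \<open>u\<close> to \<open>S(t,u)\<close> adds the derivative of the leading
coefficient along \<open>F\<close>.\<close>

lemma codefect_reverse_expansion:
  "O_pow (p + 2) (\<lambda>t. codefect 0 (- t) (S t u) - t ^ p *\<^sub>R codefect_coeff p u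
      - t ^ Suc p *\<^sub>R (codefect_coeff_deriv p u - codefect_coeff (Suc p) u))"
proof -
  obtain r M where r: "0 < r" "r \<le> T" "0 \<le> M" "\<And>t v. \<bar>t\<bar> < r \<Longrightarrow> norm (v - u) < r \<Longrightarrow>
       norm (codefect 0 t v - t ^ p *\<^sub>R codefect_coeff p v - t ^ Suc p *\<^sub>R codefect_coeff (Suc p) v) \<le> M * \<bar>t\<bar> ^ (p + 2)"
    using codefect_taylor[OF codefect_coeff_0] by metis
  note S1 = O_pow_1_of_velocity[OF S_expansion[of u]]
  obtain d where d: "0 < d" "\<And>t. t \<noteq> 0 \<Longrightarrow> \<bar>t\<bar> < d \<Longrightarrow> norm (S t u - u) < r"
    using O_pow_eventually_small[of 0 "\<lambda>t. S t u - u" r] S1 r(1) by (metis One_nat_def)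
  have 1: "O_pow (p + 2) (\<lambda>t. codefect 0 (- t) (S t u) - t ^ p *\<^sub>R codefect_coeff p (S t u) + t ^ Suc p *\<^sub>R codefect_coeff (Suc p) (S t u))"
  proof (rule O_powI)
    show "0 < min r d" using r d by simp
    fix t :: real assume "t \<noteq> 0" "\<bar>t\<bar> < min r d"
    then show "norm (codefect 0 (- t) (S t u) - t ^ p *\<^sub>R codefect_coeff p (S t u) + t ^ Suc p *\<^sub>R codefect_coeff (Suc p) (S t u)) \<le> M * \<bar>t\<bar> ^ (p + 2)"
      using r(4)[of "- t" "S t u"] d(2)[of t] even_p by simp
  qed
  have 2: "O_pow (p + 2) (\<lambda>t. t ^ p *\<^sub>R (codefect_coeff p (S t u) - codefect_coeff p u - t *\<^sub>R codefect_coeff_deriv p u))"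
    by (rule O_pow_scaleR_power[OF codefect_coeff_along_velocity[OF S_expansion]])
  have 3: "O_pow (p + 2) (\<lambda>t. t ^ Suc p *\<^sub>R (codefect_coeff (Suc p) (S t u) - codefect_coeff (Suc p) u))"
    using O_pow_scaleR_power[OF codefect_coeff_along[OF S1, of "Suc p"], of "Suc p"] by simp
  show ?thesis
    using O_pow_diff[OF O_pow_add[OF 1 2] 3]
    by (rule O_pow_cong[OF _ zero_less_one]) (simp add: algebra_simps)
qed

lemma defect_expansion:
  "O_pow (p + 2) (\<lambda>t. defect t u - t ^ p *\<^sub>R codefect_coeff p u
      - t ^ Suc p *\<^sub>R (codefect_coeff_deriv p u - codefect_coeff (Suc p) u + DF 1 u [codefect_coeff p u]))"
proof -
  let ?f = "\<lambda>t. codefect 0 (- t) (S t u)" and ?b = "codefect_coeff p u" and ?c = "codefect_coeff_deriv p u - codefect_coeff (Suc p) u"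
  interpret DF: bounded_linear "\<lambda>h. DF 1 u [h]" by (rule DF_bounded_linear)
  have 1: "O_pow (p + 1) (\<lambda>t. ?f t - t ^ p *\<^sub>R ?b)"
    using O_pow_add[OF O_pow_mono[OF codefect_reverse_expansion[of u], of "p + 1"] O_pow_power[of "p + 1" ?c]] by simp
  then have 2: "O_pow (p + 2) (\<lambda>t. t *\<^sub>R DF 1 u [?f t - t ^ p *\<^sub>R ?b])"
    using O_pow_scaleR_id[OF O_pow_bounded_linear[OF DF_bounded_linear 1]] by simp
  have "O_pow p ?f"
    using O_pow_add[OF O_pow_mono[OF 1, of p] O_pow_power[of p ?b]] by simp
  from transport_along[OF this, of u]
  have "O_pow (p + 2) (\<lambda>t. (transport t u (?f t) - ?f t - t *\<^sub>R DF 1 u [?f t])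
      + (?f t - t ^ p *\<^sub>R ?b - t ^ Suc p *\<^sub>R ?c) + t *\<^sub>R DF 1 u [?f t - t ^ p *\<^sub>R ?b])"
    by (rule O_pow_add[OF O_pow_add[OF _ codefect_reverse_expansion] 2])
  then show ?thesis
    by (rule O_pow_cong[OF _ T_pos])
       (simp only: defect_eq, simp add: DF.diff DF.scaleR algebra_simps del: One_nat_def)
qed

text \<open>In the mean of defect and codefect the coefficient of degree \<open>p + 1\<close> of the codefect cancels.\<close>

lemma sym_defect_expansion:
  "O_pow (p + 2) (\<lambda>t. sym_defect t u - t ^ p *\<^sub>R codefect_coeff p u
      - (t ^ Suc p / 2) *\<^sub>R (codefect_coeff_deriv p u + DF 1 u [codefect_coeff p u]))"
proof -
  let ?b = "codefect_coeff p u" and ?c = "codefect_coeff (Suc p) u" and ?d = "codefect_coeff_deriv p u" and ?e = "DF 1 u [codefect_coeff p u]"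
  have key: "(1 / 2) *\<^sub>R (a + b) - x *\<^sub>R ?b - (y / 2) *\<^sub>R (?d + ?e)
      = (1 / 2) *\<^sub>R ((a - x *\<^sub>R ?b - y *\<^sub>R (?d - ?c + ?e)) + (b - x *\<^sub>R ?b - y *\<^sub>R ?c))" for a b x y
  proof -
    have "(a - x *\<^sub>R ?b - y *\<^sub>R (?d - ?c + ?e)) + (b - x *\<^sub>R ?b - y *\<^sub>R ?c)
        = (a + b) - (x *\<^sub>R ?b + x *\<^sub>R ?b) - y *\<^sub>R (?d + ?e)"
      by (simp add: scaleR_add_right scaleR_diff_right)
    then show ?thesis by (simp only: scaleR_diff_right scaleR_half_double) simp
  qed
  show ?thesis
    using O_pow_scaleR[OF O_pow_add[OF defect_expansion[of u] codefect_expansion[of u]], of "1 / 2"]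
    by (rule O_pow_cong[OF _ T_pos]) (simp only: sym_defect_eq key)
qed

text \<open>As \<open>S - E\<close> is \<open>O(t^(p+1))\<close>, linearizing \<open>F\<close> and moving its derivative to \<open>u\<close> costs at most one more power of
\<open>t\<close>.\<close>

lemma F_difference:
  assumes "O_pow (p + 2) (\<lambda>t. S t u - E t u - t ^ (p + 1) *\<^sub>R a)"
  shows "O_pow (p + 2) (\<lambda>t. F (S t u) - F (E t u) - t ^ (p + 1) *\<^sub>R DF 1 u [a])"
proof -
  let ?L = "\<lambda>t. S t u - E t u"
  interpret DF: bounded_linear "\<lambda>h. DF 1 u [h]" by (rule DF_bounded_linear)
  obtain r M where r: "0 < r" "0 \<le> M" "\<And>v w. norm (v - u) < r \<Longrightarrow> norm (w - u) < r \<Longrightarrow>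
       norm (F v - F w - DF 1 w [v - w]) \<le> M * (norm (v - w))\<^sup>2"
    using F_local[of u] by metis
  obtain r' M' where r': "0 < r'" "0 \<le> M'" "\<And>w vs. w \<in> ball u r' \<Longrightarrow> length vs = 1 \<Longrightarrow>
       norm (DF 1 w vs - DF 1 u vs) \<le> M' * norm (w - u) * list_norm vs"
    using frechet_derivatives_local_estimates[OF derivatives_F UNIV_I[of u], where k = 1]
    by (metis centre_in_ball)
  have L: "O_pow (p + 1) ?L"
    using O_pow_add[OF O_pow_mono[OF assms, of "p + 1"] O_pow_power[of "p + 1" a]] by simp
  obtain d where d: "0 < d" "\<And>t. t \<noteq> 0 \<Longrightarrow> \<bar>t\<bar> < d \<Longrightarrow> norm (S t u - u) < r"
    using O_pow_eventually_small[of 0 "\<lambda>t. S t u - u" r] O_pow_1_of_velocity[OF S_expansion[of u]] r(1) by (metis One_nat_def)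
  obtain d' where d': "0 < d'" "\<And>t. t \<noteq> 0 \<Longrightarrow> \<bar>t\<bar> < d' \<Longrightarrow> norm (E t u - u) < min r r'"
    using O_pow_eventually_small[of 0 "\<lambda>t. E t u - u" "min r r'"] E_minus_initial[of u] r(1) r'(1)
    by (metis One_nat_def min_less_iff_conj)
  have "O_pow ((p + 1) + (p + 1)) (\<lambda>t. F (S t u) - F (E t u) - DF 1 (E t u) [?L t])"
    by (rule O_pow_mult_dominated[OF L L, of "min d d'" M])
       (use r d d' in \<open>auto simp: power2_eq_square mult.assoc\<close>)
  then have 1: "O_pow (p + 2) (\<lambda>t. F (S t u) - F (E t u) - DF 1 (E t u) [?L t])"
    by (rule O_pow_mono) simp
  have "O_pow (1 + (p + 1)) (\<lambda>t. DF 1 (E t u) [?L t] - DF 1 u [?L t])"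
  proof (rule O_pow_mult_dominated[OF E_minus_initial L d'(1) r'(2)])
    fix t :: real assume "t \<noteq> 0" "\<bar>t\<bar> < d'"
    then have "E t u \<in> ball u r'" using d'(2) by (simp add: dist_norm norm_minus_commute)
    from r'(3)[OF this, of "[?L t]"]
    show "norm (DF 1 (E t u) [?L t] - DF 1 u [?L t]) \<le> M' * norm (E t u - u) * norm (?L t)" by simp
  qed
  then have 2: "O_pow (p + 2) (\<lambda>t. DF 1 (E t u) [?L t] - DF 1 u [?L t])" by simp
  show ?thesis
    using O_pow_add[OF O_pow_add[OF 1 2] O_pow_bounded_linear[OF DF_bounded_linear assms, of u]]
    by (rule O_pow_cong[OF _ zero_less_one]) (simp add: DF.diff DF.scaleR del: One_nat_def)
qed

text \<open>Integration of \<open>(S - E)' = A + F(S) - F(E)\<close>. The term \<open>F(S) - F(E)\<close> enters at degree \<open>p + 1\<close> through the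
leading term of \<open>S - E\<close>, which is already known from the backward expansion.\<close>

lemma scheme_minus_flow_expansion_forward:
  "O_pow (p + 3) (\<lambda>t. S t u - E t u - (t ^ Suc p / Suc p) *\<^sub>R codefect_coeff p u
      - (t ^ (p + 2) / (p + 2)) *\<^sub>R (codefect_coeff_deriv p u - codefect_coeff (Suc p) u + DF 1 u [codefect_coeff p u]
          + (1 / Suc p) *\<^sub>R DF 1 u [codefect_coeff p u]))"
proof -
  let ?b = "codefect_coeff p u" and ?e = "DF 1 u [codefect_coeff p u]"
  let ?a = "codefect_coeff_deriv p u - codefect_coeff (Suc p) u + ?e"
  interpret DF: bounded_linear "\<lambda>h. DF 1 u [h]" by (rule DF_bounded_linear)
  have L: "O_pow (p + 1) (\<lambda>t. S t u - E t u)"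
    using order unfolding has_order_def O_pow_def by blast
  \<comment> \<open>The backward expansion, truncated after its leading term.\<close>
  have L2: "O_pow (p + 2) (\<lambda>t. S t u - E t u - t ^ (p + 1) *\<^sub>R ((1 / Suc p) *\<^sub>R ?b))"
  proof -
    have "O_pow (p + 2) (\<lambda>t. (S t u - E t u - (t ^ Suc p / Suc p) *\<^sub>R (?b + t *\<^sub>R codefect_coeff_deriv p u)
      - (t ^ (p + 2) / (p + 2)) *\<^sub>R (codefect_coeff (Suc p) u - codefect_coeff_deriv p u))
      + t ^ (p + 2) *\<^sub>R ((1 / Suc p) *\<^sub>R codefect_coeff_deriv p u + (1 / (p + 2)) *\<^sub>R (codefect_coeff (Suc p) u - codefect_coeff_deriv p u)))"
      by (rule O_pow_add[OF O_pow_mono[OF scheme_minus_flow_expansion_backward[OF codefect_coeff_0]] O_pow_power]) auto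
    then show ?thesis
      by (rule O_pow_cong[OF _ zero_less_one]) (simp add: algebra_simps)
  qed
  have "O_pow (p + 2) (\<lambda>t. (defect t u - t ^ p *\<^sub>R ?b - t ^ Suc p *\<^sub>R ?a)
      + (F (S t u) - F (E t u) - t ^ (p + 1) *\<^sub>R DF 1 u [(1 / Suc p) *\<^sub>R ?b]))"
    by (rule O_pow_add[OF defect_expansion F_difference[OF L2]])
  then have L': "O_pow (p + 2) (\<lambda>t. D 1 (t, u) [(1, 0)] - F (E t u) - t ^ p *\<^sub>R ?b
      - t ^ Suc p *\<^sub>R (?a + (1 / Suc p) *\<^sub>R ?e))"
    by (rule O_pow_cong[OF _ zero_less_one]) (simp add: DF.scaleR algebra_simps power_add del: One_nat_def)
  have pow: "((\<lambda>t. (t ^ Suc n / Suc n) *\<^sub>R c) has_vector_derivative s ^ n *\<^sub>R c) (at s)" for n s and c :: 'a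
  proof -
    have "((\<lambda>t. t ^ Suc n / Suc n) has_real_derivative s ^ n) (at s)"
      by (auto intro!: derivative_eq_intros simp del: power_Suc of_nat_Suc)
    then show ?thesis
      using has_vector_derivative_scaleR[of "\<lambda>t. t ^ Suc n / Suc n" _ s UNIV "\<lambda>_. c" 0] by simp
  qed
  have "O_pow (Suc (p + 2)) (\<lambda>t. S t u - E t u - (t ^ Suc p / Suc p) *\<^sub>R ?b
      - (t ^ Suc (Suc p) / Suc (Suc p)) *\<^sub>R (?a + (1 / Suc p) *\<^sub>R ?e))"
  proof (rule O_pow_of_derivative[OF _ T_pos _ L'])
    show "((\<lambda>t. S t u - E t u - (t ^ Suc p / Suc p) *\<^sub>R ?b
        - (t ^ Suc (Suc p) / Suc (Suc p)) *\<^sub>R (?a + (1 / Suc p) *\<^sub>R ?e)) has_vector_derivative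
        D 1 (s, u) [(1, 0)] - F (E s u) - s ^ p *\<^sub>R ?b - s ^ Suc p *\<^sub>R (?a + (1 / Suc p) *\<^sub>R ?e)) (at s)"
      if "\<bar>s\<bar> < T" for s
      by (intro has_vector_derivative_diff pow S_has_time_derivative E_derivative that)
  qed (simp add: S_0 E_0)
  then show ?thesis by (simp add: numeral_3_eq_3)
qed

abbreviation S_hat :: "real \<Rightarrow> 'a \<Rightarrow> 'a" where
  "S_hat \<equiv> corrected_scheme F p S"

text \<open>The two expansions of \<open>S - E\<close> differ in form, and only their mean is free of the coefficient of degree
\<open>p + 1\<close> of the codefect. That mean coincides with the expansion of \<open>t/(p+1)\<close> times the symmetrized
defect.\<close>

lemma corrected_error: "O_pow (p + 3) (\<lambda>t. S_hat t u - E t u)"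
proof -
  let ?b = "codefect_coeff p u" and ?c = "codefect_coeff (Suc p) u" and ?d = "codefect_coeff_deriv p u" and ?e = "DF 1 u [codefect_coeff p u]"
  let ?L1 = "\<lambda>t. (t ^ Suc p / Suc p) *\<^sub>R (?b + t *\<^sub>R ?d) + (t ^ (p + 2) / (p + 2)) *\<^sub>R (?c - ?d)"
  let ?L2 = "\<lambda>t. (t ^ Suc p / Suc p) *\<^sub>R ?b + (t ^ (p + 2) / (p + 2)) *\<^sub>R (?d - ?c + ?e + (1 / Suc p) *\<^sub>R ?e)"
  let ?D = "\<lambda>t. t ^ p *\<^sub>R ?b + (t ^ Suc p / 2) *\<^sub>R (?d + ?e)"
  have 1: "O_pow (p + 3) (\<lambda>t. S t u - E t u - ?L1 t)"
    using scheme_minus_flow_expansion_backward[of p u] codefect_coeff_0 by (simp only: diff_diff_eq add.assoc)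
  have 2: "O_pow (p + 3) (\<lambda>t. S t u - E t u - ?L2 t)"
    using scheme_minus_flow_expansion_forward[of u] by (simp only: diff_diff_eq add.assoc)
  have 3: "O_pow (p + 3) (\<lambda>t. t *\<^sub>R (sym_defect t u - ?D t))"
    using O_pow_scaleR_id[OF sym_defect_expansion[of u]] by (simp add: diff_diff_eq numeral_3_eq_3)
  have eq: "(1 / 2) *\<^sub>R (?L1 t + ?L2 t) = (t / (p + 1)) *\<^sub>R ?D t" for t
  proof -
    let ?\<alpha> = "t ^ Suc p / real (Suc p)" and ?\<eta> = "t ^ (p + 2) / real (p + 2)"
    have "?\<eta> * (1 + 1 / real (Suc p)) = ?\<alpha> * t"
      by (simp add: divide_simps)
    then have e: "?\<eta> *\<^sub>R (?e + (1 / Suc p) *\<^sub>R ?e) = (?\<alpha> * t) *\<^sub>R ?e"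
      by (metis (no_types) scaleR_add_left scaleR_one scaleR_scaleR)
    have "?L1 t + ?L2 t = (?\<alpha> *\<^sub>R ?b + ?\<alpha> *\<^sub>R ?b) + (?\<alpha> * t) *\<^sub>R ?d + ?\<eta> *\<^sub>R (?e + (1 / Suc p) *\<^sub>R ?e)"
      by (simp add: scaleR_add_right scaleR_diff_right)
    also have "\<dots> = (?\<alpha> *\<^sub>R ?b + ?\<alpha> *\<^sub>R ?b) + (?\<alpha> * t) *\<^sub>R (?d + ?e)"
      unfolding e by (simp add: scaleR_add_right)
    finally have sum: "?L1 t + ?L2 t = (?\<alpha> *\<^sub>R ?b + ?\<alpha> *\<^sub>R ?b) + (?\<alpha> * t) *\<^sub>R (?d + ?e)" .
    have half: "(1 / 2) *\<^sub>R ((x + x) + y) = x + (1 / 2) *\<^sub>R y" for x y :: 'a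
      by (simp add: scaleR_add_right[of "1 / 2" "x + x" y])
    have "(1 / 2) *\<^sub>R (?L1 t + ?L2 t) = ?\<alpha> *\<^sub>R ?b + (1 / 2) *\<^sub>R ((?\<alpha> * t) *\<^sub>R (?d + ?e))"
      unfolding sum by (rule half)
    then show ?thesis by (simp add: scaleR_add_right[of "t / _"] mult_ac add.commute)
  qed
  have "O_pow (p + 3) (\<lambda>t. (1 / 2) *\<^sub>R ((S t u - E t u - ?L1 t) + (S t u - E t u - ?L2 t))
      - (1 / (p + 1)) *\<^sub>R (t *\<^sub>R (sym_defect t u - ?D t)))"
    by (rule O_pow_diff[OF O_pow_scaleR[OF O_pow_add[OF 1 2]] O_pow_scaleR[OF 3]])
  moreover have "(1 / 2) *\<^sub>R ((x - a) + (x - b)) = x - (1 / 2) *\<^sub>R (a + b)" for x a b :: 'a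
    by (simp add: algebra_simps flip: scaleR_2)
  ultimately have "O_pow (p + 3) (\<lambda>t. S t u - E t u - (t / (p + 1)) *\<^sub>R ?D t
      - (1 / (p + 1)) *\<^sub>R (t *\<^sub>R (sym_defect t u - ?D t)))"
    by (simp only: eq)
  then show ?thesis
    by (rule O_pow_cong[OF _ zero_less_one])
       (simp add: corrected_scheme_def scaleR_diff_right)
qed

text \<open>The radius \<open>r\<close> is chosen small enough that one step from the \<open>r\<close>-ball stays inside a prescribed ball, where
estimates of another function are known.\<close>

lemma S_local:
  assumes "0 < R"
  obtains r M where "0 < r" "r \<le> R" "r \<le> T" "0 \<le> M"
    "\<And>t v. \<bar>t\<bar> < r \<Longrightarrow> norm (v - u) < r \<Longrightarrow> norm (S t v - u) < R"
    "\<And>t v w. \<bar>t\<bar> < r \<Longrightarrow> norm (v - u) < r \<Longrightarrow> norm (w - u) < r \<Longrightarrow> norm (S t v - S t w) \<le> M * norm (v - w)"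
    "\<And>t v w. \<bar>t\<bar> < r \<Longrightarrow> norm (v - u) < r \<Longrightarrow> norm (w - u) < r \<Longrightarrow>
       norm (S t v - S t w - transport t w (v - w)) \<le> M * (norm (v - w))\<^sup>2"
proof -
  obtain r M where r: "0 < r" "r \<le> T" "0 \<le> M"
    "\<And>s v t w vs. \<bar>s\<bar> < r \<Longrightarrow> norm (v - u) < r \<Longrightarrow> \<bar>t\<bar> < r \<Longrightarrow> norm (w - u) < r \<Longrightarrow> length vs = 0 \<Longrightarrow>
       norm (D 0 (s, v) vs - D 0 (t, w) vs) \<le> M * norm (s - t, v - w) * list_norm vs"
    "\<And>s v t w vs. \<bar>s\<bar> < r \<Longrightarrow> norm (v - u) < r \<Longrightarrow> \<bar>t\<bar> < r \<Longrightarrow> norm (w - u) < r \<Longrightarrow> length vs = 0 \<Longrightarrow>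
       norm (D 0 (s, v) vs - D 0 (t, w) vs - D (Suc 0) (t, w) ((s - t, v - w) # vs))
         \<le> M * (norm (s - t, v - w))\<^sup>2 * list_norm vs"
    using D_local[of u 0] by metis
  \<comment> \<open>With this radius \<open>norm (S t v - u) \<le> M (\<bar>t\<bar> + norm (v - u)) < 2 M r' < R\<close>.\<close>
  define r' where "r' = min (min r R) (R / (2 * M + 1))"
  show thesis
  proof (rule that[of r' M])
    show "0 < r'" "r' \<le> R" "r' \<le> T" "0 \<le> M" using r assms by (auto simp: r'_def)
    fix t v assume t: "\<bar>t\<bar> < r'" and v: "norm (v - u) < r'"
    have "norm (S t v - u) \<le> M * norm (t, v - u)"
      using r(4)[of t v 0 u "[]"] t v r(1,2) T_pos by (simp add: D_0 S_0 r'_def)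
    also have "\<dots> \<le> M * (r' + r')"
      using norm_Pair_le[of t "v - u"] t v r(3) by (intro mult_left_mono) auto
    also have "\<dots> \<le> (2 * M + 1) * r' - r'" by (simp add: algebra_simps)
    also have "\<dots> < (2 * M + 1) * r'" using \<open>0 < r'\<close> by simp
    also have "\<dots> \<le> (2 * M + 1) * (R / (2 * M + 1))"
      using r(3) by (intro mult_left_mono) (auto simp: r'_def)
    also have "\<dots> = R" using r(3) by simp
    finally show "norm (S t v - u) < R" .
    fix w assume w: "norm (w - u) < r'"
    show "norm (S t v - S t w) \<le> M * norm (v - w)"
      using r(4)[of t v t w "[]"] t v w r(2) by (simp add: D_0 r'_def)
    show "norm (S t v - S t w - transport t w (v - w)) \<le> M * (norm (v - w))\<^sup>2"
      using r(5)[of t v t w "[]"] t v w r(2) by (simp add: D_0 r'_def)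
  qed
qed

text \<open>Taylor expansion in \<open>t\<close> of \<open>B(t,v) - B(t,w)\<close>: the first \<open>p\<close> coefficients vanish, and the derivative of
order \<open>p\<close> is Lipschitz in the initial value.\<close>

lemma codefect_lipschitz:
  obtains r M where "0 < r" "r \<le> T" "0 \<le> M"
    "\<And>t v. \<bar>t\<bar> < r \<Longrightarrow> norm (v - u) < r \<Longrightarrow> norm (codefect 0 t v) \<le> M * \<bar>t\<bar> ^ p"
    "\<And>t v w. \<bar>t\<bar> < r \<Longrightarrow> norm (v - u) < r \<Longrightarrow> norm (w - u) < r \<Longrightarrow>
       norm (codefect 0 t v - codefect 0 t w) \<le> M * \<bar>t\<bar> ^ p * norm (v - w)"
proof -
  obtain r M where r: "0 < r" "r \<le> T" "0 \<le> M"
    "\<And>t v. \<bar>t\<bar> < r \<Longrightarrow> norm (v - u) < r \<Longrightarrow> norm (codefect p t v) \<le> M"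
    "\<And>t v w. \<bar>t\<bar> < r \<Longrightarrow> norm (v - u) < r \<Longrightarrow> norm (w - u) < r \<Longrightarrow>
       norm (codefect p t v - codefect p t w) \<le> M * norm (v - w)"
    using codefect_local[of u p] by metis
  have B0: "codefect j 0 v = 0" if "j < p" for j v
    using codefect_coeff_0[OF that, of v] by (simp add: codefect_coeff_def)
  have "norm (codefect 0 t v) \<le> M * \<bar>t\<bar> ^ p" if "\<bar>t\<bar> < r" "norm (v - u) < r" for t v
    using taylor_remainder_bound[of r "\<lambda>j t. codefect j t v" p M t] r that codefect_has_derivative B0 by simp
  moreover have "norm (codefect 0 t v - codefect 0 t w) \<le> M * \<bar>t\<bar> ^ p * norm (v - w)"
    if "\<bar>t\<bar> < r" "norm (v - u) < r" "norm (w - u) < r" for t v w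
    using taylor_remainder_bound[of r "\<lambda>j t. codefect j t v - codefect j t w" p "M * norm (v - w)" t] r that
      codefect_has_derivative B0 by (simp add: has_vector_derivative_diff mult_ac)
  ultimately show thesis using that r by blast
qed

text \<open>The defect inherits the estimate from the codefect through \<open>A(t,v) = d2 S(t,v) B(-t, S(t,v))\<close>, as a product of
Lipschitz functions.\<close>

lemma sym_defect_lipschitz:
  obtains r M where "0 < r" "r \<le> T" "0 \<le> M"
    "\<And>t v w. \<bar>t\<bar> < r \<Longrightarrow> norm (v - u) < r \<Longrightarrow> norm (w - u) < r \<Longrightarrow>
       norm (sym_defect t v - sym_defect t w) \<le> M * \<bar>t\<bar> ^ p * norm (v - w)"
proof -
  obtain r1 M1 where 1: "0 < r1" "r1 \<le> T" "0 \<le> M1"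
    "\<And>t v. \<bar>t\<bar> < r1 \<Longrightarrow> norm (v - u) < r1 \<Longrightarrow> norm (codefect 0 t v) \<le> M1 * \<bar>t\<bar> ^ p"
    "\<And>t v w. \<bar>t\<bar> < r1 \<Longrightarrow> norm (v - u) < r1 \<Longrightarrow> norm (w - u) < r1 \<Longrightarrow>
       norm (codefect 0 t v - codefect 0 t w) \<le> M1 * \<bar>t\<bar> ^ p * norm (v - w)"
    using codefect_lipschitz[of u] by metis
  obtain r2 M2 where 2: "0 < r2" "r2 \<le> r1" "0 \<le> M2"
    "\<And>t v. \<bar>t\<bar> < r2 \<Longrightarrow> norm (v - u) < r2 \<Longrightarrow> norm (S t v - u) < r1"
    "\<And>t v w. \<bar>t\<bar> < r2 \<Longrightarrow> norm (v - u) < r2 \<Longrightarrow> norm (w - u) < r2 \<Longrightarrow> norm (S t v - S t w) \<le> M2 * norm (v - w)"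
    using S_local[OF 1(1), of u] by metis
  obtain r3 M3 where 3: "0 < r3" "r3 \<le> T" "0 \<le> M3"
    "\<And>t v vs. \<bar>t\<bar> < r3 \<Longrightarrow> norm (v - u) < r3 \<Longrightarrow> length vs = 1 \<Longrightarrow> norm (D 1 (t, v) vs) \<le> M3 * list_norm vs"
    "\<And>s v t w vs. \<bar>s\<bar> < r3 \<Longrightarrow> norm (v - u) < r3 \<Longrightarrow> \<bar>t\<bar> < r3 \<Longrightarrow> norm (w - u) < r3 \<Longrightarrow> length vs = 1 \<Longrightarrow>
       norm (D 1 (s, v) vs - D 1 (t, w) vs) \<le> M3 * norm (s - t, v - w) * list_norm vs"
    using D_local[of u 1] by metis
  define r where "r = min r2 r3"
  show thesis
  proof (rule that[of r "M3 * M1 + M3 * M1 * M2 + M1"])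
    show "0 < r" "r \<le> T" "0 \<le> M3 * M1 + M3 * M1 * M2 + M1" using 1 2 3 by (auto simp: r_def)
    fix t v w assume t: "\<bar>t\<bar> < r" and v: "norm (v - u) < r" and w: "norm (w - u) < r"
    have tT: "\<bar>t\<bar> < T" using t 3(2) by (simp add: r_def)
    have t2: "\<bar>t\<bar> < r2" "\<bar>t\<bar> < r1" "\<bar>- t\<bar> < r1" "\<bar>t\<bar> < r3" and v2: "norm (v - u) < r2" "norm (v - u) < r1" "norm (v - u) < r3"
      and w2: "norm (w - u) < r2" "norm (w - u) < r1" "norm (w - u) < r3"
      using t v w 2(2) by (auto simp: r_def)
    let ?bv = "codefect 0 (- t) (S t v)" and ?bw = "codefect 0 (- t) (S t w)" and ?n = "norm (v - w)"
    have bv: "norm ?bv \<le> M1 * \<bar>t\<bar> ^ p"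
      using 1(4)[OF t2(3) 2(4)[OF t2(1) v2(1)]] by simp
    have "norm (?bv - ?bw) \<le> M1 * \<bar>t\<bar> ^ p * norm (S t v - S t w)"
      using 1(5)[OF t2(3) 2(4)[OF t2(1) v2(1)] 2(4)[OF t2(1) w2(1)]] by simp
    also have "\<dots> \<le> M1 * \<bar>t\<bar> ^ p * (M2 * ?n)"
      using 2(5)[OF t2(1) v2(1) w2(1)] 1(3) by (intro mult_left_mono) auto
    finally have bvw: "norm (?bv - ?bw) \<le> M1 * \<bar>t\<bar> ^ p * (M2 * ?n)" .
    have "defect t v - defect t w = (transport t v ?bv - transport t w ?bv) + transport t w (?bv - ?bw)"
      unfolding defect_eq[OF tT] using linear_diff[OF bounded_linear.linear[OF transport_bounded_linear[OF tT]]] by simp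
    also have "norm \<dots> \<le> M3 * ?n * (M1 * \<bar>t\<bar> ^ p) + M3 * (M1 * \<bar>t\<bar> ^ p * (M2 * ?n))"
    proof (rule norm_triangle_mono)
      have "norm (transport t v ?bv - transport t w ?bv) \<le> M3 * ?n * norm ?bv"
        using 3(5)[of t v t w "[(0, ?bv)]"] t2 v2 w2 by simp
      also have "\<dots> \<le> M3 * ?n * (M1 * \<bar>t\<bar> ^ p)" using bv 3(3) by (intro mult_left_mono) auto
      finally show "norm (transport t v ?bv - transport t w ?bv) \<le> M3 * ?n * (M1 * \<bar>t\<bar> ^ p)" .
      have "norm (transport t w (?bv - ?bw)) \<le> M3 * norm (?bv - ?bw)"
        using 3(4)[of t w "[(0, ?bv - ?bw)]"] t2 w2 by simp
      also have "\<dots> \<le> M3 * (M1 * \<bar>t\<bar> ^ p * (M2 * ?n))" using bvw 3(3) by (intro mult_left_mono) auto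
      finally show "norm (transport t w (?bv - ?bw)) \<le> M3 * (M1 * \<bar>t\<bar> ^ p * (M2 * ?n))" .
    qed
    finally have A: "norm (defect t v - defect t w) \<le> M3 * ?n * (M1 * \<bar>t\<bar> ^ p) + M3 * (M1 * \<bar>t\<bar> ^ p * (M2 * ?n))" .
    have B: "norm (codefect 0 t v - codefect 0 t w) \<le> M1 * \<bar>t\<bar> ^ p * ?n"
      by (rule 1(5)[OF t2(2) v2(2) w2(2)])
    have "sym_defect t v - sym_defect t w = (1 / 2) *\<^sub>R ((defect t v - defect t w) + (codefect 0 t v - codefect 0 t w))"
      unfolding sym_defect_eq[OF tT] by (simp add: algebra_simps)
    then have "norm (sym_defect t v - sym_defect t w) = (1 / 2) * norm ((defect t v - defect t w) + (codefect 0 t v - codefect 0 t w))"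
      by (simp only: norm_scaleR)
    also have "\<dots> \<le> norm (defect t v - defect t w) + norm (codefect 0 t v - codefect 0 t w)"
      using norm_triangle_ineq[of "defect t v - defect t w" "codefect 0 t v - codefect 0 t w"]
        norm_ge_zero[of "defect t v - defect t w + (codefect 0 t v - codefect 0 t w)"] by linarith
    also have "\<dots> \<le> (M3 * M1 + M3 * M1 * M2 + M1) * \<bar>t\<bar> ^ p * ?n"
      using A B by (simp add: algebra_simps)
    finally show "norm (sym_defect t v - sym_defect t w) \<le> (M3 * M1 + M3 * M1 * M2 + M1) * \<bar>t\<bar> ^ p * ?n" .
  qed
qed

text \<open>With \<open>w = S(t,u)\<close> and the correction \<open>d = t/(p+1) D(t,u)\<close>, the result of the backward step is \<open>u\<close> plus two
remainders: the second-order remainder of \<open>S(-t,_)\<close> at \<open>w\<close>, of size \<open>O(d^2)\<close>, and \<open>t/(p+1)\<close> times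
\<open>D(-t, w - d) - D(-t, w)\<close>. The linear terms cancel by covariance of the symmetrized defect.\<close>

lemma corrected_almost_self_adjoint:
  "O_pow (2 * p + 2) (\<lambda>t. S_hat (- t) (S_hat t u) - u)"
proof -
  define d where "d t = (t / (p + 1)) *\<^sub>R sym_defect t u" for t
  have S_hat: "S_hat t u = S t u - d t" for t
    by (simp add: corrected_scheme_def d_def)
  have "O_pow p (\<lambda>t. (sym_defect t u - t ^ p *\<^sub>R codefect_coeff p u - (t ^ Suc p / 2) *\<^sub>R (codefect_coeff_deriv p u + DF 1 u [codefect_coeff p u]))
      + t ^ p *\<^sub>R codefect_coeff p u + t ^ Suc p *\<^sub>R ((1 / 2) *\<^sub>R (codefect_coeff_deriv p u + DF 1 u [codefect_coeff p u])))"
    by (intro O_pow_add O_pow_mono[OF sym_defect_expansion] O_pow_power O_pow_mono[OF O_pow_power]) simp_all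
  then have "O_pow p (\<lambda>t. sym_defect t u)"
    by (rule O_pow_cong[OF _ zero_less_one]) simp
  then have d_small: "O_pow (p + 1) d"
    using O_pow_scaleR[OF O_pow_scaleR_id, of p "\<lambda>t. sym_defect t u" "1 / (p + 1)"] unfolding d_def by simp
  obtain r1 M1 where 1: "0 < r1" "r1 \<le> T" "0 \<le> M1"
    "\<And>t v w. \<bar>t\<bar> < r1 \<Longrightarrow> norm (v - u) < r1 \<Longrightarrow> norm (w - u) < r1 \<Longrightarrow>
       norm (S t v - S t w - transport t w (v - w)) \<le> M1 * (norm (v - w))\<^sup>2"
    using S_local[OF T_pos, of u] by metis
  obtain r2 M2 where 2: "0 < r2" "r2 \<le> T" "0 \<le> M2"
    "\<And>t v w. \<bar>t\<bar> < r2 \<Longrightarrow> norm (v - u) < r2 \<Longrightarrow> norm (w - u) < r2 \<Longrightarrow>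
       norm (sym_defect t v - sym_defect t w) \<le> M2 * \<bar>t\<bar> ^ p * norm (v - w)"
    using sym_defect_lipschitz[of u] by metis
  define r where "r = min r1 r2"
  have "0 < r" using 1 2 by (simp add: r_def)
  obtain d1 where d1: "0 < d1" "\<And>t. t \<noteq> 0 \<Longrightarrow> \<bar>t\<bar> < d1 \<Longrightarrow> norm (S t u - u) < r"
    using O_pow_eventually_small[of 0 "\<lambda>t. S t u - u" r] O_pow_1_of_velocity[OF S_expansion[of u]] \<open>0 < r\<close> by (metis One_nat_def)
  have "O_pow 1 (\<lambda>t. S t u - d t - u)"
    using O_pow_diff[OF O_pow_1_of_velocity[OF S_expansion[of u]] O_pow_mono[OF d_small, of 1]] by (simp add: algebra_simps)
  then obtain d2 where d2: "0 < d2" "\<And>t. t \<noteq> 0 \<Longrightarrow> \<bar>t\<bar> < d2 \<Longrightarrow> norm (S t u - d t - u) < r"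
    using O_pow_eventually_small[of 0 "\<lambda>t. S t u - d t - u" r] \<open>0 < r\<close> by (metis One_nat_def)
  define \<delta> where "\<delta> = min r (min d1 d2)"
  have \<delta>: "0 < \<delta>" using \<open>0 < r\<close> d1 d2 by (simp add: \<delta>_def)
  define R1 where "R1 t = S (- t) (S t u - d t) - S (- t) (S t u) - transport (- t) (S t u) ((S t u - d t) - S t u)" for t
  define R2 where "R2 t = sym_defect (- t) (S t u - d t) - sym_defect (- t) (S t u)" for t
  have near: "\<bar>- t\<bar> < r1" "\<bar>- t\<bar> < r2" "\<bar>t\<bar> < T" "norm (S t u - u) < r1" "norm (S t u - u) < r2"
    "norm (S t u - d t - u) < r1" "norm (S t u - d t - u) < r2" if "t \<noteq> 0" "\<bar>t\<bar> < \<delta>" for t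
    using d1(2)[of t] d2(2)[of t] that 1(2) by (auto simp: \<delta>_def r_def)
  have 3: "O_pow ((p + 1) + (p + 1)) R1"
  proof (rule O_pow_mult_dominated[OF d_small d_small \<delta> 1(3)])
    fix t assume "t \<noteq> 0" "\<bar>t\<bar> < \<delta>"
    note n = near[OF this]
    show "norm (R1 t) \<le> M1 * norm (d t) * norm (d t)"
      unfolding R1_def using 1(4)[OF n(1) n(6) n(4)] by (simp add: power2_eq_square mult.assoc)
  qed
  have "O_pow (p + (p + 1)) R2"
  proof (rule O_pow_mult_dominated[OF O_pow_power[of p "1::real"] d_small \<delta> 2(3)])
    fix t assume "t \<noteq> 0" "\<bar>t\<bar> < \<delta>"
    note n = near[OF this]
    show "norm (R2 t) \<le> M2 * norm (t ^ p *\<^sub>R (1::real)) * norm (d t)"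
      unfolding R2_def using 2(4)[OF n(2) n(7) n(5)] by (simp add: power_abs)
  qed
  then have 4: "O_pow (Suc (p + (p + 1))) (\<lambda>t. (1 / (p + 1)) *\<^sub>R (t *\<^sub>R R2 t))"
    by (intro O_pow_scaleR O_pow_scaleR_id)
  have "(p + 1) + (p + 1) = 2 * p + 2" "Suc (p + (p + 1)) = 2 * p + 2" by simp_all
  then have "O_pow (2 * p + 2) (\<lambda>t. R1 t + (1 / (p + 1)) *\<^sub>R (t *\<^sub>R R2 t))"
    using O_pow_add 3 4 by metis
  then show ?thesis
  proof (rule O_pow_cong[OF _ \<delta>])
    fix t assume t: "t \<noteq> 0" "\<bar>t\<bar> < \<delta>"
    have tT: "\<bar>t\<bar> < T" "\<bar>- t\<bar> < T" using near[OF t] by auto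
    interpret transport: bounded_linear "transport (- t) (S t u)" by (rule transport_bounded_linear[OF tT(2)])
    have "transport (- t) (S t u) ((S t u - d t) - S t u) = - (t / (p + 1)) *\<^sub>R sym_defect (- t) (S t u)"
      unfolding sym_defect_reverse[OF tT(1)] d_def by (simp add: linear_neg[OF transport.linear_axioms] transport.scaleR del: One_nat_def)
    then show "S_hat (- t) (S_hat t u) - u = R1 t + (1 / (p + 1)) *\<^sub>R (t *\<^sub>R R2 t)"
      unfolding S_hat R1_def R2_def S_reverse[OF tT(1)]
      by (simp add: corrected_scheme_def scaleR_diff_right)
  qed
qed

end

theorem theorem4:
  fixes F :: "'a::banach \<Rightarrow> 'a"
    and E S :: "real \<Rightarrow> 'a \<Rightarrow> 'a"
    and T :: real
    and p :: nat
  assumes "smooth_bounded_derivatives F"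
    and "exact_flow F E"
    and "one_step_scheme T S"
    and "self_adjoint T S"
    and "has_order S E p"
    and "even p" and "p \<ge> 2"
  shows "(\<forall>u0.
            (\<lambda>t. norm (corrected_scheme F p S (- t) (corrected_scheme F p S t u0) - u0))
               \<in> O[at 0](\<lambda>t. t ^ (2 * p + 2)) \<and>
            (\<lambda>t. norm (corrected_scheme F p S t u0 - E t u0)) \<in> O[at 0](\<lambda>t. t ^ (p + 3))) \<and>
         has_order (corrected_scheme F p S) E (p + 2) \<and> even (p + 2)"
proof -
  obtain DF where DF: "frechet_derivatives_on UNIV F DF"
    using assms(1) unfolding smooth_bounded_derivatives_def by blast
  obtain D where D: "frechet_derivatives_on ({-T<..<T} \<times> UNIV) (\<lambda>(t, u). S t u) D"
    using assms(3) unfolding one_step_scheme_def smooth_on_def by blast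
  interpret self_adjoint_scheme_and_flow F E S T D DF p
    using assms DF D by unfold_locales (auto simp: one_step_scheme_def)
  have "O_pow (2 * p + 2) (\<lambda>t. corrected_scheme F p S (- t) (corrected_scheme F p S t u) - u)"
    and "O_pow (p + 3) (\<lambda>t. corrected_scheme F p S t u - E t u)" for u
    by (rule corrected_almost_self_adjoint corrected_error)+
  moreover have "p + 2 + 1 = p + 3" by simp
  ultimately show ?thesis
    using \<open>even p\<close> unfolding O_pow_def has_order_def by (metis even_add even_numeral)
qed

end
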